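(* Let $m,k\ge 1$, $f\in\mathbb{Q}^m\setminus\mathbb{Z}^m$ and $r^1,\dots,r^k\in\mathbb{Q}^m\setminus\{0\}$, and assume the set $X=\{(x,s)\in\mathbb{Z}^m\times\mathbb{R}^k_+ : x=f+\sum_{j=1}^k r^j s_j\}$ is nonempty. Let $P=\{(x,s)\in\mathbb{R}^m\times\mathbb{R}^k_+ : x=f+\sum_{j=1}^k r^j s_j\}$ be its linear relaxation. Let $L$ be a rational lattice-free polytope in $\mathbb{R}^m$ containing $f$ in its interior and having rays going into its corners. Then the $L$-cut $\sum_{j=1}^k \psi(r^j)s_j\ge 1$ has finite split rank with respect to $P$ if and only if $L$ has the 2-hyperplane property.
   Context: A convex set is lattice-free if its interior contains no point of $\mathbb{Z}^m$. $\psi$ is the gauge of $L-f$: $\psi(r)=\inf\{t>0 : r/t\in L-f\}$; the inequality $\sum_j\psi(r^j)s_j\ge 1$ is called the $L$-cut. For $j=1,\dots,k$, the boundary point of ray $r^j$ is the intersection of the half-line $\{f+\lambda r^j:\lambda\ge 0\}$ with the boundary of $L$; $L$ has rays going into its corners if every vertex of $L$ is the boundary point of at least one $r^j$. A split is a pair $(\pi,\pi_0)$ with $\pi\in\mathbb{Z}^m$, $\pi_0\in\mathbb{Z}$, acting on the $x$ variables; its boundary hyperplanes are $\{\pi x=\pi_0\}$ and $\{\pi x=\pi_0+1\}$. For a polyhedron $Q$ in $(x,s)$-space, $Q(\pi,\pi_0)=\mathrm{conv}\big((Q\cap\{\pi x\le\pi_0\})\cup(Q\cap\{\pi x\ge \pi_0+1\})\big)$.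 The split closure of $Q$ is the intersection of $Q(\pi,\pi_0)$ over all splits; the rank-0 split closure is $Q$, and the rank-$t$ split closure is the split closure of the rank-$(t-1)$ split closure. The split rank of an inequality valid for $\mathrm{conv}(X)$ with respect to $Q$ is the smallest $t\ge0$ such that it is valid for the rank-$t$ split closure of $Q$, or $+\infty$ if no such $t$ exists. A set $S\subseteq\mathbb{R}^m$ is 2-partitionable if $|S|\le 1$ or there is a partition of $S$ into nonempty sets $S_1,S_2$ and a split such that $S_1$ lies on one boundary hyperplane of the split and $S_2$ on the other. A polytope is 2-partitionable if its set of integer points is. For a rational lattice-free polytope $L$, let $L_I$ be the convex hull of the integer points in $L$; $L$ has the 2-hyperplane property if every face of $L_I$ that is not contained in a facet of $L$ is 2-partitionable. *)

theory Defs
  imports "HOL-Analysis.Analysis" "HOL-Library.Extended_Nat"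
begin

definition int_vec :: "real^'m \<Rightarrow> bool" where
  "int_vec x \<longleftrightarrow> (\<forall>i. x $ i \<in> \<int>)"

definition rat_vec :: "real^'m \<Rightarrow> bool" where
  "rat_vec x \<longleftrightarrow> (\<forall>i. x $ i \<in> \<rat>)"

definition lattice_free :: "(real^'m) set \<Rightarrow> bool" where
  "lattice_free L \<longleftrightarrow> convex L \<and> (\<forall>z. int_vec z \<longrightarrow> z \<notin> interior L)"

definition rational_polytope :: "(real^'m) set \<Rightarrow> bool" where
  "rational_polytope L \<longleftrightarrow> (\<exists>V. finite V \<and> (\<forall>v\<in>V. rat_vec v) \<and> L = convex hull V)"

definition gauge :: "(real^'m) set \<Rightarrow> real^'m \<Rightarrow> real^'m \<Rightarrow> real" where
  "gauge L f r = Inf {t. t > 0 \<and> f + (1 / t) *\<^sub>R r \<in> L}"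

definition ray_boundary_points :: "(real^'m) set \<Rightarrow> real^'m \<Rightarrow> real^'m \<Rightarrow> (real^'m) set" where
  "ray_boundary_points L f r = {f + c *\<^sub>R r | c. c \<ge> 0} \<inter> frontier L"

definition rays_into_corners :: "(real^'m) set \<Rightarrow> real^'m \<Rightarrow> ('k \<Rightarrow> real^'m) \<Rightarrow> bool" where
  "rays_into_corners L f r \<longleftrightarrow>
     (\<forall>v. v extreme_point_of L \<longrightarrow> (\<exists>j. v \<in> ray_boundary_points L f (r j)))"

definition split_disj :: "real^'m \<Rightarrow> int \<Rightarrow> ((real^'m) \<times> (real^'k)) set \<Rightarrow> ((real^'m) \<times> (real^'k)) set" where
  "split_disj \<pi> \<pi>0 Q = convex hull ((Q \<inter> {p. \<pi> \<bullet> fst p \<le> of_int \<pi>0}) \<union>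
                                     (Q \<inter> {p. \<pi> \<bullet> fst p \<ge> of_int \<pi>0 + 1}))"

definition split_closure :: "((real^'m) \<times> (real^'k)) set \<Rightarrow> ((real^'m) \<times> (real^'k)) set" where
  "split_closure Q = (\<Inter>{split_disj \<pi> \<pi>0 Q | \<pi> \<pi>0. int_vec \<pi>})"

definition split_rank :: "((real^'m) \<times> (real^'k)) set \<Rightarrow> ((real^'m) \<times> (real^'k)) set \<Rightarrow> enat" where
  "split_rank Q H =
     (if \<exists>t. (split_closure ^^ t) Q \<subseteq> H then enat (LEAST t. (split_closure ^^ t) Q \<subseteq> H) else \<infinity>)"

definition two_partitionable :: "(real^'m) set \<Rightarrow> bool" where
  "two_partitionable S \<longleftrightarrow>
     (\<exists>a. S \<subseteq> {a}) \<or>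
     (\<exists>S1 S2 \<pi> (\<pi>0::int). S1 \<noteq> {} \<and> S2 \<noteq> {} \<and> S1 \<union> S2 = S \<and> S1 \<inter> S2 = {} \<and> int_vec \<pi> \<and>
        ((S1 \<subseteq> {x. \<pi> \<bullet> x = of_int \<pi>0} \<and> S2 \<subseteq> {x. \<pi> \<bullet> x = of_int \<pi>0 + 1}) \<or>
         (S1 \<subseteq> {x. \<pi> \<bullet> x = of_int \<pi>0 + 1} \<and> S2 \<subseteq> {x. \<pi> \<bullet> x = of_int \<pi>0})))"

definition int_hull :: "(real^'m) set \<Rightarrow> (real^'m) set" where
  "int_hull L = convex hull (L \<inter> {z. int_vec z})"

definition two_hyperplane_property :: "(real^'m) set \<Rightarrow> bool" where
  "two_hyperplane_property L \<longleftrightarrow>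
     (\<forall>F. F face_of int_hull L \<and> \<not> (\<exists>G. G facet_of L \<and> F \<subseteq> G) \<longrightarrow>
          two_partitionable (F \<inter> {z. int_vec z}))"

end

theory Submission
  imports Defs
begin

text \<open>
  \<^emph>\<open>Infinite rank.\<close> Let \<open>S\<close> be the set of integer points of a face of \<open>L\<^sub>I\<close> that is in no facet of
  \<open>L\<close> and is not 2-partitionable. The barycentre of \<open>S\<close> is interior to \<open>L\<close>, hence lifts to a
  point cut off by the \<open>L\<close>-cut. Whatever the split, a fixed proportion of the
  violation survives: if the barycentre lies strictly between the two hyperplanes, some point of \<open>S\<close>
  is off both of them, and moving halfway to it leaves the slab.

  \<^emph>\<open>Finite rank.\<close> An affine bound on the violation \<open>1 - \<Sum>\<^sub>j \<psi>(r\<^sub>j) s\<^sub>j\<close> that holds strictly at the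
  integer points holds on some split closure, by a compactness argument. For an integral
  functional \<open>\<pi>\<close> with maximum \<open>\<pi>\<^sub>0\<close> over \<open>L\<^sub>I\<close>, we obtain the bound \<open>c (\<pi>\<^sub>0 - \<pi> x)\<close> for all small
  \<open>c > 0\<close> by induction on the number of integer points of the exposed face.
  If the face is in a facet of \<open>L\<close>, one further split after the strict bound suffices; otherwise
  the bounds for the two parts of its 2-partition are combined by the partitioning split. The
  theorem is the case \<open>\<pi> = 0\<close>.
\<close>

section \<open>Integer and rational vectors; integral normals of facets\<close>

lemma inner_int_vec:
  assumes "int_vec a" "int_vec z"
  shows "a \<bullet> z \<in> \<int>"
  using assms by (auto simp: int_vec_def inner_vec_def intro!: Ints_sum)

lemma int_vec_axis: "int_vec (axis k 1)"
  by (auto simp: int_vec_def axis_def)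

lemma finite_int_vec_bounded:
  fixes B :: "(real^'m) set"
  assumes "bounded B"
  shows "finite (B \<inter> {z. int_vec z})"
proof -
  obtain b where b: "\<And>x. x \<in> B \<Longrightarrow> norm x \<le> b"
    using assms bounded_iff by blast
  let ?I = "of_int ` {\<lfloor>-b\<rfloor>..\<lceil>b\<rceil>} :: real set"
  have "z $ i \<in> ?I" if z: "z \<in> B" "int_vec z" for z i
  proof -
    obtain k where k: "z $ i = of_int k"
      using z(2) by (auto simp: int_vec_def elim: Ints_cases)
    have "\<bar>z $ i\<bar> \<le> b"
      using b[OF z(1)] component_le_norm_cart[of z i] by linarith
    then have "k \<in> {\<lfloor>-b\<rfloor>..\<lceil>b\<rceil>}"
      unfolding k by (auto simp: floor_le_iff le_ceiling_iff)
    with k show ?thesis by blast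
  qed
  then have "(\<lambda>z. ($) z) ` (B \<inter> {z. int_vec z}) \<subseteq> UNIV \<rightarrow>\<^sub>E ?I"
    by auto
  moreover have "finite (UNIV \<rightarrow>\<^sub>E ?I :: ('m \<Rightarrow> real) set)"
    by (intro finite_PiE) auto
  ultimately have "finite ((\<lambda>z. ($) z) ` (B \<inter> {z. int_vec z}))"
    by (rule finite_subset)
  then show ?thesis
    by (rule finite_imageD) (auto simp: inj_on_def vec_eq_iff fun_eq_iff)
qed

text \<open>A \<open>\<rat>\<close>-linear map \<open>\<real> \<rightarrow> \<rat>\<close> that does not kill some coordinate
  of the real solution turns it into a rational one.\<close>

lemma rational_orthogonal_vector:
  fixes a :: "real^'m" and W :: "(real^'m) set"
  assumes "a \<noteq> 0" and W: "\<And>w. w \<in> W \<Longrightarrow> rat_vec w" and orth: "\<And>w. w \<in> W \<Longrightarrow> a \<bullet> w = 0"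
  obtains b :: "real^'m" where "b \<noteq> 0" "rat_vec b" "\<And>w. w \<in> W \<Longrightarrow> b \<bullet> w = 0"
proof -
  interpret Q: vector_space "\<lambda>(q::rat) (x::real). of_rat q * x"
    by unfold_locales (auto simp: algebra_simps of_rat_add of_rat_mult)
  obtain i0 where i0: "a $ i0 \<noteq> 0"
    using \<open>a \<noteq> 0\<close> by (auto simp: vec_eq_iff)
  have ind: "Q.independent {a $ i0}"
    using i0 by (simp add: Q.dependent_single)
  define B where "B = Q.extend_basis {a $ i0}"
  have B: "Q.independent B" "Q.span B = UNIV" "a $ i0 \<in> B"
    using Q.independent_extend_basis[OF ind] Q.span_extend_basis[OF ind]
      Q.extend_basis_superset[OF ind] by (auto simp: B_def)
  \<comment> \<open>\<open>B\<close> is a Hamel basis of the reals over the rationals that contains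
    \<open>a $ i0\<close>, and \<open>\<phi>\<close> is the coordinate along that element. It is
    rational-linear and sends \<open>a $ i0\<close> to 1, which keeps \<open>b\<close>
    nonzero.\<close>
  define \<phi> where "\<phi> v = Q.representation B v (a $ i0)" for v
  have \<phi>_scale: "\<phi> (of_rat q * v) = q * \<phi> v" for q v
    using Q.representation_scale[OF B(1), of v q] B(2) by (simp add: \<phi>_def)
  have \<phi>_sum: "\<phi> (\<Sum>i\<in>I. g i) = (\<Sum>i\<in>I. \<phi> (g i))" for I :: "'m set" and g
    using Q.representation_sum[OF B(1), of I g] B(2) by (simp add: \<phi>_def)
  have "\<phi> (a $ i0) = 1"
    using Q.representation_basis[OF B(1) B(3)] by (simp add: \<phi>_def)
  define b :: "real^'m" where "b = (\<chi> i. of_rat (\<phi> (a $ i)))"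
  show thesis
  proof
    show "b \<noteq> 0"
      using \<open>\<phi> (a $ i0) = 1\<close> by (auto simp: b_def vec_eq_iff intro!: exI[of _ i0])
    show "rat_vec b"
      by (simp add: rat_vec_def b_def)
    fix w assume w: "w \<in> W"
    then have "\<forall>i. \<exists>q. w $ i = of_rat q"
      using W[OF w] unfolding rat_vec_def by (metis Rats_cases)
    then obtain q where q: "\<And>i. w $ i = of_rat (q i)"
      by metis
    \<comment> \<open>The coordinates of \<open>w\<close> are rational, so \<open>\<phi>\<close> can
      be applied term by term to the equation \<open>a \<bullet> w = 0\<close>.\<close>
    have "0 = \<phi> (\<Sum>i\<in>UNIV. of_rat (q i) * a $ i)"
      using orth[OF w] \<phi>_scale[of 0 0] by (simp add: inner_vec_def q mult.commute)
    also have "\<dots> = (\<Sum>i\<in>UNIV. q i * \<phi> (a $ i))"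
      by (simp add: \<phi>_sum \<phi>_scale)
    finally have "(\<Sum>i\<in>UNIV. q i * \<phi> (a $ i)) = 0" by simp
    then have "of_rat (\<Sum>i\<in>UNIV. q i * \<phi> (a $ i)) = (0::real)"
      by simp
    then show "b \<bullet> w = 0"
      by (simp add: inner_vec_def b_def q of_rat_sum of_rat_mult mult.commute)
  qed
qed

text \<open>The product of denominators of the coordinates clears all of them at once.\<close>

lemma rat_vec_scale_int_vec:
  assumes "rat_vec (b :: real^'m)"
  obtains n :: nat where "n > 0" "int_vec (real n *\<^sub>R b)"
proof -
  have "\<exists>n::nat. n > 0 \<and> real n * b $ i \<in> \<int>" for i
  proof -
    obtain q where q: "b $ i = of_rat q"
      using assms by (auto simp: rat_vec_def elim: Rats_cases)
    obtain x y where xy: "quotient_of q = (x, y)" by fastforce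
    have y: "y > 0" using quotient_of_denom_pos[OF xy] .
    have "b $ i = of_int x / of_int y"
      using quotient_of_div[OF xy] q by (simp add: of_rat_divide)
    then have "real (nat y) * b $ i = of_int x"
      using y by simp
    then show ?thesis
      using y by (intro exI[of _ "nat y"]) auto
  qed
  then obtain n :: "'m \<Rightarrow> nat" where n: "\<And>i. n i > 0" "\<And>i. real (n i) * b $ i \<in> \<int>"
    by metis
  show thesis
  proof
    show "(\<Prod>i\<in>UNIV. n i) > 0"
      using n(1) by (simp add: prod_pos)
    show "int_vec (real (\<Prod>i\<in>UNIV. n i) *\<^sub>R b)"
      unfolding int_vec_def
    proof
      fix i
      have "real (\<Prod>i\<in>UNIV. n i) * b $ i = real (\<Prod>j\<in>UNIV-{i}. n j) * (real (n i) * b $ i)"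
        by (subst prod.remove[of UNIV i]) auto
      then show "(real (\<Prod>i\<in>UNIV. n i) *\<^sub>R b) $ i \<in> \<int>"
        using Ints_mult[OF Ints_of_nat n(2)[of i], of "\<Prod>j\<in>UNIV-{i}. n j"]
        unfolding vector_scaleR_component real_scaleR_def by metis
    qed
  qed
qed

text \<open>The component of \<open>c\<close> orthogonal to \<open>a\<close> is annihilated by
  \<open>c\<close> as well, hence is orthogonal to itself and vanishes.\<close>

lemma hyperplane_functional_parallel:
  fixes a c :: "'a::euclidean_space"
  assumes "a \<noteq> 0" and orth: "\<And>y. a \<bullet> y = 0 \<Longrightarrow> c \<bullet> y = 0"
  shows "c = ((c \<bullet> a) / (a \<bullet> a)) *\<^sub>R a"
proof -
  define y where "y = c - ((c \<bullet> a) / (a \<bullet> a)) *\<^sub>R a"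
  have ay: "a \<bullet> y = 0"
    using \<open>a \<noteq> 0\<close> by (simp add: y_def inner_diff_right inner_commute)
  then have "c \<bullet> y = 0" by (rule orth)
  with ay have "y \<bullet> y = 0"
    by (subst (1) y_def) (simp add: inner_diff_left)
  then show ?thesis by (simp add: y_def)
qed

text \<open>Differences of vertices of the facet are rational and span the direction space of a
  hyperplane. A nonzero rational vector orthogonal to them exists and must be a multiple of any
  given normal. Integrality is what later allows the normal to enter a split.\<close>

lemma rational_polytope_facet_int_normal:
  fixes L :: "(real^'m) set"
  assumes L: "rational_polytope L" and int: "interior L \<noteq> {}" and G: "G facet_of L"
  obtains g b where "int_vec g" "g \<noteq> 0" "\<And>x. x \<in> L \<Longrightarrow> g \<bullet> x \<le> b" "G = L \<inter> {x. g \<bullet> x = b}"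
proof -
  obtain V where V: "finite V" "\<And>v. v \<in> V \<Longrightarrow> rat_vec v" "L = convex hull V"
    using L by (auto simp: rational_polytope_def)
  have Gf: "G face_of convex hull V"
    using G V(3) facet_of_imp_face_of by blast
  then obtain S where S: "S \<subseteq> V" "G = convex hull S"
    using face_of_convex_hull_subset[OF finite_imp_compact[OF V(1)]] by metis
  have "G \<noteq> {}" using G by (simp add: facet_of_def)
  then obtain v0 where v0: "v0 \<in> S" using S by auto
  have "aff_dim L = DIM(real^'m)"
    using int by (simp add: aff_dim_nonempty_interior)
  then have "aff_dim G = DIM(real^'m) - 1"
    using G by (simp add: facet_of_def)
  then obtain h \<beta>' where h: "h \<noteq> 0" "affine hull G = {x. h \<bullet> x = \<beta>'}"
    using aff_dim_eq_hyperplane[of G] by auto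
  have "polyhedron L"
    using V(1,3) polyhedron_convex_hull by blast
  then obtain a \<beta> where a: "a \<noteq> 0" "L \<subseteq> {x. a \<bullet> x \<le> \<beta>}" "G = L \<inter> {x. a \<bullet> x = \<beta>}"
    using facet_of_polyhedron[OF _ G] by blast
  have hS: "h \<bullet> (v - v0) = 0" if "v \<in> S" for v
    using hull_inc[of _ S convex] hull_subset[of G affine] h(2) S(2) that v0
    by (auto simp: inner_diff_right)
  have "rat_vec (v - v0)" if "v \<in> S" for v
  proof -
    have "rat_vec v" "rat_vec v0" using V(2) S(1) v0 that by auto
    then show ?thesis by (simp add: rat_vec_def)
  qed
  then have "\<And>w. w \<in> (\<lambda>v. v - v0) ` S \<Longrightarrow> rat_vec w" "\<And>w. w \<in> (\<lambda>v. v - v0) ` S \<Longrightarrow> h \<bullet> w = 0"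
    using hS by blast+
  from rational_orthogonal_vector[OF h(1) this]
  obtain c where c: "c \<noteq> 0" "rat_vec c" "\<And>v. v \<in> S \<Longrightarrow> c \<bullet> (v - v0) = 0"
    by (metis (no_types, lifting) imageI)
  \<comment> \<open>A functional that is constant on \<open>S\<close> is constant on its affine
    hull, which is the hyperplane with normal \<open>h\<close>. Both the outer normal
    \<open>a\<close> and the rational vector \<open>c\<close> are therefore multiples of
    \<open>h\<close>.\<close>
  have par: "d = ((d \<bullet> h) / (h \<bullet> h)) *\<^sub>R h" if d: "\<And>v. v \<in> S \<Longrightarrow> d \<bullet> (v - v0) = 0" for d
  proof (rule hyperplane_functional_parallel[OF h(1)])
    fix y assume y: "h \<bullet> y = 0"
    have "S \<subseteq> {x. d \<bullet> x = d \<bullet> v0}"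
      using d by (auto simp: inner_diff_right)
    then have "affine hull S \<subseteq> {x. d \<bullet> x = d \<bullet> v0}"
      by (simp add: affine_hyperplane hull_minimal)
    moreover have "affine hull G = affine hull S"
      by (simp add: S(2))
    moreover have "v0 + y \<in> affine hull G"
      using h(2) y v0 S(2) hull_inc[of v0 S convex] hull_subset[of G affine]
      by (auto simp: inner_add_right)
    ultimately show "d \<bullet> y = 0"
      by (auto simp: inner_add_right)
  qed
  have "a \<bullet> (v - v0) = 0" if "v \<in> S" for v
    using hull_inc[of _ S convex] that v0 a(3) S(2) by (auto simp: inner_diff_right)
  then have ah: "a = ((a \<bullet> h) / (h \<bullet> h)) *\<^sub>R h"
    by (rule par)
  have ch: "c = ((c \<bullet> h) / (h \<bullet> h)) *\<^sub>R h"
    using c(3) by (rule par)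
  obtain n where n: "n > 0" "int_vec (real n *\<^sub>R c)"
    using rat_vec_scale_int_vec[OF c(2)] .
  define k where "k = real n * (c \<bullet> h) / (a \<bullet> h)"
  have "a \<bullet> h \<noteq> 0" "c \<bullet> h \<noteq> 0"
    using ah ch a(1) c(1) by (metis div_0 scaleR_zero_left)+
  then have k0: "k \<noteq> 0" using n(1) by (simp add: k_def)
  have nc: "real n *\<^sub>R c = k *\<^sub>R a"
    by (subst ah, subst ch) (use \<open>a \<bullet> h \<noteq> 0\<close> in \<open>simp add: k_def\<close>)
  \<comment> \<open>The sign is chosen so that \<open>g\<close> is a positive multiple of
    \<open>a\<close> and points outwards.\<close>
  define g where "g = (if k > 0 then real n *\<^sub>R c else - (real n *\<^sub>R c))"
  have g: "g = \<bar>k\<bar> *\<^sub>R a" using k0 by (auto simp: g_def nc)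
  show thesis
  proof
    show "int_vec g"
      using n(2) by (auto simp: g_def int_vec_def)
    show "g \<noteq> 0" using g k0 a(1) by simp
    show "g \<bullet> x \<le> \<bar>k\<bar> * \<beta>" if "x \<in> L" for x
      using a(2) that by (auto simp: g intro!: mult_left_mono)
    show "G = L \<inter> {x. g \<bullet> x = \<bar>k\<bar> * \<beta>}"
      using k0 by (simp add: a(3) g)
  qed
qed

section \<open>Iterated split closures\<close>

lemma split_closure_subset_split_disj:
  "int_vec a \<Longrightarrow> split_closure Q \<subseteq> split_disj a a0 Q"
  unfolding split_closure_def by blast

lemma convex_split_closure: "convex (split_closure Q)"
  unfolding split_closure_def by (rule convex_Inter) (auto simp: split_disj_def)

lemma split_disj_subset:
  "convex Q \<Longrightarrow> split_disj a a0 Q \<subseteq> Q"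
  unfolding split_disj_def by (rule hull_minimal) auto

lemma split_closure_subset:
  assumes "convex Q"
  shows "split_closure Q \<subseteq> Q"
proof -
  have "int_vec 0" by (simp add: int_vec_def)
  then show ?thesis
    using split_closure_subset_split_disj[of 0 Q 0] split_disj_subset[OF assms, of 0 0] by blast
qed

lemma int_vec_in_split_disj:
  assumes "p \<in> Q" "int_vec (fst p)" "int_vec a"
  shows "p \<in> split_disj a a0 Q"
proof -
  obtain k where k: "a \<bullet> fst p = of_int k"
    using inner_int_vec[OF assms(3,2)] by (elim Ints_cases)
  have "k \<le> a0 \<or> k \<ge> a0 + 1" by linarith
  then have "real_of_int k \<le> of_int a0 \<or> real_of_int k \<ge> of_int a0 + 1"
    by (metis of_int_1 of_int_add of_int_le_iff)
  then show ?thesis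
    unfolding split_disj_def using assms(1) k by (intro hull_inc) auto
qed

lemma convex_split_closure_power:
  "convex Q \<Longrightarrow> convex ((split_closure ^^ t) Q)"
  by (cases t) (auto intro: convex_split_closure)

lemma split_closure_power_antimono:
  assumes "convex Q" "t \<le> t'"
  shows "(split_closure ^^ t') Q \<subseteq> (split_closure ^^ t) Q"
  using assms(2)
proof (induction rule: dec_induct)
  case (step n)
  then show ?case
    using split_closure_subset[OF convex_split_closure_power[OF assms(1), of n]] by auto
qed simp

lemma int_vec_in_split_closure_power:
  assumes "p \<in> Q" "int_vec (fst p)"
  shows "p \<in> (split_closure ^^ t) Q"
proof (induction t)
  case (Suc t)
  then show ?case
    using int_vec_in_split_disj[OF _ assms(2)] by (auto simp: split_closure_def)
qed (use assms in simp)

text \<open>A segment joining the two sides can be clipped at the two hyperplanes without leaving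
  the convex set \<open>Q\<close>. Once the ends are on the hyperplanes, the weights depend only on
  the height of \<open>p\<close> in the slab, which makes them pass to limits.\<close>

lemma split_disj_slab_segment:
  assumes Q: "convex Q" and p: "p \<in> split_disj a a0 Q"
    and slab: "of_int a0 < a \<bullet> fst p" "a \<bullet> fst p < of_int a0 + 1"
  obtains y z where "y \<in> Q" "z \<in> Q" "a \<bullet> fst y = of_int a0" "a \<bullet> fst z = of_int a0 + 1"
    "p = (of_int a0 + 1 - a \<bullet> fst p) *\<^sub>R y + (a \<bullet> fst p - of_int a0) *\<^sub>R z"
proof -
  define \<alpha> where "\<alpha> q = a \<bullet> fst q - of_int a0" for q :: "(real^'a) \<times> (real^'b)"
  have \<alpha>_comb: "\<alpha> (u *\<^sub>R y + v *\<^sub>R z) = u * \<alpha> y + v * \<alpha> z" if "u + v = 1" for u v y z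
  proof -
    have "of_int a0 = (u + v) * real_of_int a0" using that by simp
    then show ?thesis
      by (simp add: \<alpha>_def inner_add_right algebra_simps del: mult_cancel_right1)
  qed
  let ?A = "Q \<inter> {p. a \<bullet> fst p \<le> of_int a0}" and ?B = "Q \<inter> {p. a \<bullet> fst p \<ge> of_int a0 + 1}"
  have "{p. a \<bullet> fst p \<le> c} = {p :: (real^'a) \<times> (real^'b). (a, 0) \<bullet> p \<le> c}"
    "{p. a \<bullet> fst p \<ge> c} = {p :: (real^'a) \<times> (real^'b). (a, 0) \<bullet> p \<ge> c}" for c
    by (auto simp: inner_prod_def)
  then have cA: "convex ?A" and cB: "convex ?B"
    using Q by (auto intro!: convex_Int simp: convex_halfspace_le convex_halfspace_ge)
  have pAB: "p \<in> convex hull (?A \<union> ?B)"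
    using p by (simp add: split_disj_def)
  have "p \<notin> ?A" "p \<notin> ?B" using slab by auto
  then have ne: "?A \<noteq> {}" "?B \<noteq> {}"
    using pAB cA cB by (metis Un_empty_left Un_empty_right hull_same)+
  then obtain u v y z where yz: "y \<in> ?A" "z \<in> ?B" "u \<ge> 0" "v \<ge> 0" "u + v = 1" "p = u *\<^sub>R y + v *\<^sub>R z"
    using pAB unfolding convex_hull_union_two[OF cA ne(1) cB ne(2)] by blast
  define A B where "A = \<alpha> y" and "B = \<alpha> z"
  have AB: "A \<le> 0" "B \<ge> 1" using yz by (auto simp: A_def B_def \<alpha>_def)
  have pt: "\<alpha> p = u * A + v * B" using yz \<alpha>_comb by (simp add: A_def B_def)
  define \<theta> where "\<theta> = \<alpha> p"
  \<comment> \<open>\<open>pt c\<close> is the point at height \<open>c\<close> on the line through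
    \<open>y\<close> and \<open>z\<close>, whose heights are \<open>A \<le> 0\<close> and
    \<open>B \<ge> 1\<close>.\<close>
  define pt where "pt c = ((B - c) / (B - A)) *\<^sub>R y + ((c - A) / (B - A)) *\<^sub>R z" for c
  have pos: "B - A > 0" using AB by simp
  have ptQ: "pt c \<in> Q" if "A \<le> c" "c \<le> B" for c
    unfolding pt_def using yz that pos
    by (intro convexD[OF Q]) (auto simp flip: add_divide_distrib)
  have \<alpha>pt: "\<alpha> (pt c) = c" for c
  proof -
    have "\<alpha> (pt c) = (B - c) / (B - A) * A + (c - A) / (B - A) * B"
      unfolding pt_def using pos
      by (subst \<alpha>_comb) (auto simp: A_def[symmetric] B_def[symmetric] simp flip: add_divide_distrib)
    also have "\<dots> = ((B - c) * A + (c - A) * B) / (B - A)"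
      by (simp add: add_divide_distrib)
    also have "(B - c) * A + (c - A) * B = c * (B - A)"
      by (simp add: algebra_simps)
    finally show ?thesis using pos by simp
  qed
  have \<theta>: "\<theta> = A + v * (B - A)"
    using pt yz(5) by (simp add: \<theta>_def algebra_simps flip: distrib_left)
  have v: "v = (\<theta> - A) / (B - A)" using \<theta> pos by simp
  have "u = 1 - v" using yz(5) by simp
  then have u: "u = (B - \<theta>) / (B - A)" unfolding v using pos by (simp add: field_simps)
  have p_pt: "p = pt \<theta>" using yz(6) u v by (simp add: pt_def)
  have comb: "pt \<theta> = (1 - \<theta>) *\<^sub>R pt 0 + \<theta> *\<^sub>R pt 1"
  proof -
    have "(B - \<theta>) / (B - A) = (1 - \<theta>) * ((B - 0) / (B - A)) + \<theta> * ((B - 1) / (B - A))"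
      "(\<theta> - A) / (B - A) = (1 - \<theta>) * ((0 - A) / (B - A)) + \<theta> * ((1 - A) / (B - A))"
      unfolding divide_inverse by algebra+
    then show ?thesis
      by (simp only: pt_def scaleR_add_left scaleR_add_right scaleR_scaleR add_ac)
  qed
  show thesis
  proof (rule that[of "pt 0" "pt 1"])
    show "pt 0 \<in> Q" "pt 1 \<in> Q" using AB by (auto intro!: ptQ)
    show "a \<bullet> fst (pt 0) = of_int a0" "a \<bullet> fst (pt 1) = of_int a0 + 1"
      using \<alpha>pt[of 0] \<alpha>pt[of 1] by (auto simp: \<alpha>_def)
    show "p = (of_int a0 + 1 - a \<bullet> fst p) *\<^sub>R pt 0 + (a \<bullet> fst p - of_int a0) *\<^sub>R pt 1"
      using p_pt comb by (simp add: \<theta>_def \<alpha>_def algebra_simps)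
  qed
qed

text \<open>Points of the iterates that approach \<open>p\<close> inside the slab are clipped to
  segments in the preceding iterate. The endpoints stay bounded, a subsequence of them converges,
  and nestedness puts the limits into every closure. Topological closures are used because the
  iterates are not shown to be closed.\<close>

lemma split_closure_limit_slab_segment:
  fixes Q :: "((real^'m) \<times> (real^'k)) set"
  defines "R \<equiv> \<lambda>t. (split_closure ^^ t) Q"
  assumes Q: "closed Q" "convex Q" and bdd: "\<And>c. bounded (Q \<inter> {p. a \<bullet> p \<ge> c})"
    and \<pi>: "int_vec \<pi>" and p: "\<And>t. p \<in> closure (R t)"
    and slab: "of_int \<pi>0 < \<pi> \<bullet> fst p" "\<pi> \<bullet> fst p < of_int \<pi>0 + 1"
  obtains y z where "\<And>t. y \<in> closure (R t)" "\<And>t. z \<in> closure (R t)" "y \<noteq> z" "p \<in> open_segment y z"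
proof -
  let ?x = "\<lambda>q :: (real^'m) \<times> (real^'k). \<pi> \<bullet> fst q"
  have RQ: "R t \<subseteq> Q" for t
    using split_closure_power_antimono[OF Q(2), of 0 t] by (simp add: R_def)
  define U where "U = {q. of_int \<pi>0 < ?x q \<and> ?x q < of_int \<pi>0 + 1}"
  have "open U"
    unfolding U_def by (intro open_Collect_conj open_Collect_less continuous_intros)
  moreover have "p \<in> U" using slab by (simp add: U_def)
  ultimately obtain e where e: "e > 0" "ball p e \<subseteq> U"
    by (metis open_contains_ball)
  \<comment> \<open>The index is shifted by one because the endpoints of the segment through a point
    of \<open>R (Suc t)\<close> lie in \<open>R t\<close>.\<close>
  have "\<exists>q\<in>R (Suc t). dist q p < min e (inverse (Suc t))" for t
    using p[of "Suc t"] e(1) unfolding closure_approachable by (metis inverse_Suc min_less_iff_conj)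
  then obtain q where q: "\<And>t. q t \<in> R (Suc t)" "\<And>t. dist (q t) p < min e (inverse (Suc t))"
    by metis
  have qU: "q t \<in> U" for t
    using q(2)[of t] e(2) by (auto simp: dist_commute)
  have q_lim: "q \<longlonglongrightarrow> p"
  proof (rule LIMSEQ_iff[THEN iffD2], intro allI impI)
    show "\<exists>no. \<forall>n\<ge>no. norm (q n - p) < r" if "r > 0" for r
    proof -
      obtain no where no: "inverse (Suc no) < r" using reals_Archimedean[OF \<open>r > 0\<close>] by auto
      have "norm (q n - p) < r" if "n \<ge> no" for n
      proof -
        have "inverse (real (Suc n)) \<le> inverse (Suc no)" using that by simp
        then show ?thesis using q(2)[of n] no unfolding dist_norm by linarith
      qed
      then show ?thesis by blast
    qed
  qed
  have "\<exists>y z. y \<in> R t \<and> z \<in> R t \<and> ?x y = of_int \<pi>0 \<and> ?x z = of_int \<pi>0 + 1 \<and>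
      q t = (of_int \<pi>0 + 1 - ?x (q t)) *\<^sub>R y + (?x (q t) - of_int \<pi>0) *\<^sub>R z" for t
  proof -
    have "q t \<in> split_disj \<pi> \<pi>0 (R t)"
      using q(1)[of t] split_closure_subset_split_disj[OF \<pi>] by (auto simp: R_def)
    moreover have "convex (R t)" unfolding R_def by (rule convex_split_closure_power[OF Q(2)])
    ultimately show ?thesis
      using split_disj_slab_segment[of "R t" "q t" \<pi> \<pi>0] qU[of t] unfolding U_def by blast
  qed
  then obtain y z where yz: "\<And>t. y t \<in> R t" "\<And>t. z t \<in> R t" "\<And>t. ?x (y t) = of_int \<pi>0"
    "\<And>t. ?x (z t) = of_int \<pi>0 + 1"
    "\<And>t. q t = (of_int \<pi>0 + 1 - ?x (q t)) *\<^sub>R y t + (?x (q t) - of_int \<pi>0) *\<^sub>R z t"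
    by metis
  \<comment> \<open>Where \<open>a\<close> is nonnegative, \<open>Q\<close> is bounded; elsewhere 0
    is an upper bound.\<close>
  obtain A where A: "\<And>p. p \<in> Q \<Longrightarrow> a \<bullet> p \<le> A"
  proof -
    obtain b where b: "\<And>p. p \<in> Q \<Longrightarrow> a \<bullet> p \<ge> 0 \<Longrightarrow> norm p \<le> b"
      using bdd[of 0] by (auto simp: bounded_iff)
    have "a \<bullet> p \<le> norm a * \<bar>b\<bar>" if "p \<in> Q" for p
    proof (cases "a \<bullet> p \<ge> 0")
      case True
      have "a \<bullet> p \<le> norm a * norm p" by (rule norm_cauchy_schwarz)
      also have "\<dots> \<le> norm a * \<bar>b\<bar>" using b[OF that True] by (intro mult_left_mono) auto
      finally show ?thesis .
    next
      case False
      moreover have "0 \<le> norm a * \<bar>b\<bar>" by simp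
      ultimately show ?thesis by linarith
    qed
    then show thesis by (rule that)
  qed
  define \<theta> where "\<theta> = ?x p - of_int \<pi>0"
  have \<theta>: "0 < \<theta>" "\<theta> < 1" using slab by (auto simp: \<theta>_def)
  define \<theta>q where "\<theta>q t = ?x (q t) - of_int \<pi>0" for t
  have \<theta>q01: "0 < \<theta>q t" "\<theta>q t < 1" for t using qU[of t] by (auto simp: \<theta>q_def U_def)
  have q_eq: "q t = (1 - \<theta>q t) *\<^sub>R y t + \<theta>q t *\<^sub>R z t" for t
    by (subst yz(5)) (simp add: \<theta>q_def algebra_simps)
  have \<theta>q_lim: "\<theta>q \<longlonglongrightarrow> \<theta>"
    unfolding \<theta>q_def \<theta>_def by (intro tendsto_intros q_lim)
  have aq_lim: "(\<lambda>t. a \<bullet> q t) \<longlonglongrightarrow> a \<bullet> p"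
    by (intro tendsto_intros q_lim)
  \<comment> \<open>\<open>q t\<close> averages \<open>y t\<close> and \<open>z t\<close>, and
    \<open>a\<close> is at most \<open>\<bar>A\<bar>\<close> at \<open>z t\<close>. The weight of
    \<open>y t\<close> tends to \<open>1 - \<theta> > 0\<close>, so these lower bounds form a
    bounded sequence; \<open>z t\<close> is treated alike. Both endpoints then lie in one compact
    upper level set.\<close>
  have lower_y: "a \<bullet> y t \<ge> (a \<bullet> q t - \<bar>A\<bar>) / (1 - \<theta>q t)" for t
  proof -
    have "\<theta>q t * (a \<bullet> z t) \<le> \<theta>q t * \<bar>A\<bar>"
      using A[of "z t"] yz(2)[of t] RQ[of t] \<theta>q01[of t] by (intro mult_left_mono) auto
    also have "\<dots> \<le> \<bar>A\<bar>" using \<theta>q01[of t] by (intro mult_left_le_one_le) auto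
    finally have "a \<bullet> q t - \<bar>A\<bar> \<le> (1 - \<theta>q t) * (a \<bullet> y t)"
      by (subst q_eq) (simp add: inner_add_right)
    then show ?thesis using \<theta>q01[of t] by (simp add: divide_le_eq mult.commute)
  qed
  have lower_z: "a \<bullet> z t \<ge> (a \<bullet> q t - \<bar>A\<bar>) / \<theta>q t" for t
  proof -
    have "(1 - \<theta>q t) * (a \<bullet> y t) \<le> (1 - \<theta>q t) * \<bar>A\<bar>"
      using A[of "y t"] yz(1)[of t] RQ[of t] \<theta>q01[of t] by (intro mult_left_mono) auto
    also have "\<dots> \<le> \<bar>A\<bar>" using \<theta>q01[of t] by (intro mult_left_le_one_le) auto
    finally have "a \<bullet> q t - \<bar>A\<bar> \<le> \<theta>q t * (a \<bullet> z t)"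
      by (subst q_eq) (simp add: inner_add_right)
    then show ?thesis using \<theta>q01[of t] by (simp add: divide_le_eq mult.commute)
  qed
  have "(\<lambda>t. (a \<bullet> q t - \<bar>A\<bar>) / (1 - \<theta>q t)) \<longlonglongrightarrow> (a \<bullet> p - \<bar>A\<bar>) / (1 - \<theta>)"
    using \<theta> by (intro tendsto_intros aq_lim \<theta>q_lim) auto
  from convergent_imp_Bseq[OF convergentI[OF this]] obtain c1 where c1: "\<And>t. \<bar>(a \<bullet> q t - \<bar>A\<bar>) / (1 - \<theta>q t)\<bar> \<le> c1"
    by (elim BseqE) (auto simp: real_norm_def)
  have "(\<lambda>t. (a \<bullet> q t - \<bar>A\<bar>) / \<theta>q t) \<longlonglongrightarrow> (a \<bullet> p - \<bar>A\<bar>) / \<theta>"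
    using \<theta> by (intro tendsto_intros aq_lim \<theta>q_lim) auto
  from convergent_imp_Bseq[OF convergentI[OF this]] obtain c2 where c2: "\<And>t. \<bar>(a \<bullet> q t - \<bar>A\<bar>) / \<theta>q t\<bar> \<le> c2"
    by (elim BseqE) (auto simp: real_norm_def)
  define C where "C = Q \<inter> {p. a \<bullet> p \<ge> - max c1 c2}"
  have "compact C"
    unfolding C_def compact_eq_bounded_closed
    using Q(1) bdd by (auto intro!: closed_Int closed_Collect_le continuous_intros)
  have yC: "y t \<in> C" for t
  proof -
    have "a \<bullet> y t \<ge> - max c1 c2" using lower_y[of t] c1[of t] by linarith
    then show ?thesis using yz(1)[of t] RQ[of t] by (auto simp: C_def)
  qed
  have zC: "z t \<in> C" for t
  proof -
    have "a \<bullet> z t \<ge> - max c1 c2" using lower_z[of t] c2[of t] by linarith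
    then show ?thesis using yz(2)[of t] RQ[of t] by (auto simp: C_def)
  qed
  have "compact (C \<times> C)" using \<open>compact C\<close> by (simp add: compact_Times)
  then obtain l and \<sigma> :: "nat \<Rightarrow> nat" where l: "strict_mono \<sigma>" "((\<lambda>t. (y t, z t)) \<circ> \<sigma>) \<longlonglongrightarrow> l"
    using yC zC unfolding compact_def by (metis (no_types, lifting) SigmaI)
  obtain y' z' where l_eq: "l = (y', z')" by (cases l)
  have y_lim: "(\<lambda>t. y (\<sigma> t)) \<longlonglongrightarrow> y'" and z_lim: "(\<lambda>t. z (\<sigma> t)) \<longlonglongrightarrow> z'"
    using tendsto_fst[OF l(2)] tendsto_snd[OF l(2)] by (auto simp: l_eq o_def)
  have clos: "v' \<in> closure (R t)" if v: "\<And>t. v t \<in> R t" and lim: "(\<lambda>t. v (\<sigma> t)) \<longlonglongrightarrow> v'" for v v' t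
  proof (rule Lim_in_closed_set[OF closed_closure _ _ lim])
    show "\<forall>\<^sub>F n in sequentially. v (\<sigma> n) \<in> closure (R t)"
      unfolding eventually_sequentially
    proof (intro exI allI impI)
      fix n assume "t \<le> n"
      then have "t \<le> \<sigma> n" using seq_suble[OF l(1), of n] by linarith
      then show "v (\<sigma> n) \<in> closure (R t)"
        using v[of "\<sigma> n"] split_closure_power_antimono[OF Q(2)] closure_subset
        unfolding R_def by blast
    qed
  qed simp
  have "(\<lambda>t. (1 - \<theta>q (\<sigma> t)) *\<^sub>R y (\<sigma> t) + \<theta>q (\<sigma> t) *\<^sub>R z (\<sigma> t)) \<longlonglongrightarrow> (1 - \<theta>) *\<^sub>R y' + \<theta> *\<^sub>R z'"
    by (intro tendsto_intros y_lim z_lim LIMSEQ_subseq_LIMSEQ[OF \<theta>q_lim l(1), unfolded o_def])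
  moreover have "(\<lambda>t. q (\<sigma> t)) \<longlonglongrightarrow> p"
    using LIMSEQ_subseq_LIMSEQ[OF q_lim l(1)] by (simp add: o_def)
  ultimately have p_eq: "p = (1 - \<theta>) *\<^sub>R y' + \<theta> *\<^sub>R z'"
    unfolding q_eq[symmetric] by (rule LIMSEQ_unique[rotated])
  have "(\<lambda>t. ?x (y (\<sigma> t))) \<longlonglongrightarrow> ?x y'" "(\<lambda>t. ?x (z (\<sigma> t))) \<longlonglongrightarrow> ?x z'"
    by (intro tendsto_intros y_lim z_lim)+
  then have "?x y' = of_int \<pi>0" "?x z' = of_int \<pi>0 + 1"
    unfolding yz(3,4) by (simp_all add: LIMSEQ_const_iff)
  then have "y' \<noteq> z'" by auto
  moreover from this have "p \<in> open_segment y' z'"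
    using p_eq \<theta> by (auto simp: in_segment)
  ultimately show thesis
    using that[OF clos[OF yz(1) y_lim] clos[OF yz(2) z_lim]] by blast
qed

text \<open>The maximum of \<open>a \<bullet> p\<close> over the limit of the closures is attained at an extreme
  point of the set of maximisers, and coordinate splits force such a point to be integral.\<close>

lemma split_closure_power_eventually_less:
  fixes Q :: "((real^'m) \<times> (real^'k)) set"
  assumes Q: "closed Q" "convex Q" and bdd: "\<And>c. bounded (Q \<inter> {p. a \<bullet> p \<ge> c})"
    and int: "\<And>p. p \<in> Q \<Longrightarrow> int_vec (fst p) \<Longrightarrow> a \<bullet> p < b"
  obtains t where "\<And>p. p \<in> (split_closure ^^ t) Q \<Longrightarrow> a \<bullet> p < b"
proof (rule ccontr)
  assume "\<not> thesis"
  define R where "R = (\<lambda>t. (split_closure ^^ t) Q)"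
  have ne: "\<exists>p\<in>R t. a \<bullet> p \<ge> b" for t
    using that \<open>\<not> thesis\<close> unfolding R_def by (meson not_le)
  have RQ: "R t \<subseteq> Q" for t
    using split_closure_power_antimono[OF Q(2), of 0 t] by (simp add: R_def)
  have clRQ: "closure (R t) \<subseteq> Q" for t
    using RQ Q(1) by (simp add: closure_minimal)
  have half: "closed {p :: (real^'m) \<times> (real^'k). a \<bullet> p \<ge> b}"
    by (intro closed_Collect_le continuous_intros)
  \<comment> \<open>\<open>N\<close> is the set of limit points that still violate the strict bound.
    If no iterate satisfies the bound, \<open>N\<close> is a nested intersection of nonempty compact
    sets.\<close>
  define N where "N = (\<Inter>t. closure (R t) \<inter> {p. a \<bullet> p \<ge> b})"
  have comp: "compact (closure (R t) \<inter> {p. a \<bullet> p \<ge> b})" for t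
    unfolding compact_eq_bounded_closed
    using bdd[of b] clRQ[of t] half by (meson Int_mono bounded_subset closed_Int closed_closure order_refl)
  have N_ne: "N \<noteq> {}"
    unfolding N_def
  proof (rule compact_nest[OF comp])
    show "closure (R t) \<inter> {p. a \<bullet> p \<ge> b} \<noteq> {}" for t
      using ne[of t] closure_subset by blast
    show "closure (R n) \<inter> {p. a \<bullet> p \<ge> b} \<subseteq> closure (R m) \<inter> {p. a \<bullet> p \<ge> b}" if "m \<le> n" for m n
      using closure_mono[OF split_closure_power_antimono[OF Q(2) that]] unfolding R_def by blast
  qed
  have N_comp: "compact N"
    unfolding N_def using comp by (intro compact_Inter) auto
  have N_conv: "convex N"
    unfolding N_def R_def
    by (intro convex_INT convex_Int convex_closure convex_split_closure_power Q(2))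
       (use convex_halfspace_ge[of b a] in auto)
  obtain p0 where p0: "p0 \<in> N" "\<And>q. q \<in> N \<Longrightarrow> a \<bullet> q \<le> a \<bullet> p0"
    using continuous_attains_sup[OF N_comp N_ne continuous_on_inner[OF continuous_on_const continuous_on_id]]
    by blast
  define M where "M = N \<inter> {q. a \<bullet> q = a \<bullet> p0}"
  have "M face_of N"
    unfolding M_def using N_conv p0(2) by (rule face_of_Int_supporting_hyperplane_le)
  moreover have "compact M"
    unfolding M_def using N_comp by (intro compact_Int_closed closed_hyperplane)
  ultimately obtain p where "p extreme_point_of M"
    using extreme_point_exists_convex[of M] face_of_imp_convex[of M N] p0(1) M_def by blast
  then have p_ext: "p extreme_point_of N"
    using extreme_point_of_face[OF \<open>M face_of N\<close>] by blast
  then have pN: "p \<in> N" by (simp add: extreme_point_of_def)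
  have p_max: "a \<bullet> q \<le> a \<bullet> p" if "q \<in> N" for q
    using \<open>p extreme_point_of M\<close> p0(2)[OF that] by (auto simp: extreme_point_of_def M_def)
  have pR: "p \<in> closure (R t)" for t using pN by (auto simp: N_def)
  have "int_vec (fst p)"
    unfolding int_vec_def
  proof (rule allI, rule ccontr)
    fix k assume k: "fst p $ k \<notin> \<int>"
    let ?\<pi> = "axis k (1::real)"
    have x: "?\<pi> \<bullet> x = x $ k" for x :: "real^'m"
      by (simp add: inner_axis inner_commute)
    have "of_int \<lfloor>fst p $ k\<rfloor> < fst p $ k"
      using k by (metis Ints_of_int of_int_floor_le order_le_less)
    moreover have "fst p $ k < of_int \<lfloor>fst p $ k\<rfloor> + 1" by simp
    ultimately obtain y z where yz: "\<And>t. y \<in> closure (R t)" "\<And>t. z \<in> closure (R t)" "y \<noteq> z"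
        "p \<in> open_segment y z"
      using split_closure_limit_slab_segment[OF Q bdd int_vec_axis[of k] pR[unfolded R_def]]
      unfolding x R_def by metis
    obtain u where u: "0 < u" "u < 1" "p = (1 - u) *\<^sub>R y + u *\<^sub>R z"
      using yz(4) by (auto simp: in_segment)
    have ap: "a \<bullet> p = (1 - u) * (a \<bullet> y) + u * (a \<bullet> z)"
      using u(3) by (simp add: inner_add_right)
    have bp: "a \<bullet> p \<ge> b" using pN by (auto simp: N_def)
    \<comment> \<open>A limit point below level \<open>b\<close> is outside \<open>N\<close>, but
      then it is below \<open>p\<close> anyway. The endpoints thus never exceed \<open>p\<close>,
      and since \<open>p\<close> is a proper average of them, both reach the same value and lie in
      \<open>N\<close>.\<close>
    have le: "a \<bullet> v \<le> a \<bullet> p" if "\<And>t. v \<in> closure (R t)" for v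
    proof (cases "a \<bullet> v \<ge> b")
      case True
      then have "v \<in> N" using that by (auto simp: N_def)
      then show ?thesis by (rule p_max)
    qed (use bp in linarith)
    have "(1 - u) * (a \<bullet> p - a \<bullet> y) + u * (a \<bullet> p - a \<bullet> z) = 0"
      using ap by (simp add: algebra_simps)
    moreover have "(1 - u) * (a \<bullet> p - a \<bullet> y) \<ge> 0" "u * (a \<bullet> p - a \<bullet> z) \<ge> 0"
      using u le[OF yz(1)] le[OF yz(2)] by auto
    ultimately have "(1 - u) * (a \<bullet> p - a \<bullet> y) = 0" "u * (a \<bullet> p - a \<bullet> z) = 0"
      by linarith+
    then have "a \<bullet> y = a \<bullet> p" "a \<bullet> z = a \<bullet> p" using u by auto
    then have "y \<in> N" "z \<in> N" using yz bp by (auto simp: N_def)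
    then show False using p_ext yz(4) by (auto simp: extreme_point_of_def)
  qed
  moreover have "p \<in> Q" using pR[of 0] clRQ[of 0] by blast
  ultimately have "a \<bullet> p < b" using int by blast
  then show False using pN by (auto simp: N_def)
qed

section \<open>Violation surviving a split closure\<close>

text \<open>The point \<open>y\<close> halfway from \<open>p\<close> to \<open>T z\<^sub>0\<close> leaves the open slab when \<open>z\<^sub>0\<close> is off its
  boundary; the loss factor \<open>1 / (2 * card S)\<close> does not depend on the split.\<close>

lemma split_closure_average_step:
  fixes Q :: "((real^'m) \<times> (real^'k)) set" and S :: "(real^'m) set"
  assumes Q: "convex Q" and S: "finite S" "\<And>z. z \<in> S \<Longrightarrow> int_vec z" "\<not> two_partitionable S"
    and T: "\<And>z. z \<in> S \<Longrightarrow> T z \<in> Q" "\<And>z. z \<in> S \<Longrightarrow> fst (T z) = z"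
    and p: "p \<in> Q" "fst p = (1 / card S) *\<^sub>R (\<Sum>z\<in>S. z)"
  shows "(1 - 1 / (2 * real (card S))) *\<^sub>R ((1 / card S) *\<^sub>R (\<Sum>z\<in>S. T z)) + (1 / (2 * real (card S))) *\<^sub>R p
    \<in> split_closure Q"
proof -
  define n where "n = real (card S)"
  have S_ne: "S \<noteq> {}" and S_sing: "\<And>a. \<not> S \<subseteq> {a}"
    using S(3) by (auto simp: two_partitionable_def)
  have "card S \<noteq> 0" using S(1) S_ne by simp
  moreover have "card S \<noteq> 1" using S_sing by (metis card_1_singletonE order_refl)
  ultimately have n2: "n \<ge> 2" by (simp add: n_def)
  define m where "m = (1 / n) *\<^sub>R (\<Sum>z\<in>S. T z)"
  define w where "w = (1 - 1 / (2 * n)) *\<^sub>R m + (1 / (2 * n)) *\<^sub>R p"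
  have mem: "w \<in> split_disj a a0 Q" if a: "int_vec a" for a a0
  proof -
    let ?C = "split_disj a a0 Q"
    have cC: "convex ?C" by (simp add: split_disj_def)
    have side: "q \<in> ?C" if "q \<in> Q" "a \<bullet> fst q \<le> of_int a0 \<or> a \<bullet> fst q \<ge> of_int a0 + 1" for q
      unfolding split_disj_def using that by (intro hull_inc) auto
    have TC: "T z \<in> ?C" if "z \<in> S" for z
      using int_vec_in_split_disj[OF T(1)[OF that] _ a] T(2)[OF that] S(2)[OF that] by simp
    have mC: "m \<in> ?C"
      unfolding m_def scaleR_sum_right using S(1) TC n2
      by (intro convex_sum[OF _ cC]) (auto simp: n_def)
    show ?thesis
    proof (cases "a \<bullet> fst p \<le> of_int a0 \<or> a \<bullet> fst p \<ge> of_int a0 + 1")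
      case True
      then show ?thesis
        unfolding w_def using side[OF p(1)] mC n2 by (intro convexD[OF cC]) auto
    next
      case False
      define \<alpha> where "\<alpha> x = a \<bullet> x - of_int a0" for x
      have slab: "0 < \<alpha> (fst p)" "\<alpha> (fst p) < 1" using False by (auto simp: \<alpha>_def)
      have "(\<Sum>z\<in>S. \<alpha> z) = n * \<alpha> (fst p)"
        using n2 by (simp add: \<alpha>_def p(2) inner_sum_right sum_subtractf n_def right_diff_distrib)
      then have sum: "0 < (\<Sum>z\<in>S. \<alpha> z)" "(\<Sum>z\<in>S. \<alpha> z) < n" using slab n2 by auto
      have \<alpha>_int: "\<alpha> z \<in> \<int>" if "z \<in> S" for z
        using inner_int_vec[OF a S(2)[OF that]] by (simp add: \<alpha>_def)
      \<comment> \<open>If \<open>\<alpha>\<close> took only the values 0 and 1 on \<open>S\<close>,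
        its mean strictly between them would make both level sets nonempty, and they would form a
        2-partition.\<close>
      have "\<exists>z\<in>S. \<alpha> z \<noteq> 0 \<and> \<alpha> z \<noteq> 1"
      proof (rule ccontr)
        assume "\<not> ?thesis"
        then have 01: "\<And>z. z \<in> S \<Longrightarrow> \<alpha> z = 0 \<or> \<alpha> z = 1" by blast
        let ?S1 = "{z\<in>S. \<alpha> z = 0}" and ?S2 = "{z\<in>S. \<alpha> z = 1}"
        have "?S2 \<noteq> {}"
        proof
          assume "?S2 = {}"
          then have "(\<Sum>z\<in>S. \<alpha> z) = 0" using 01 by (intro sum.neutral) auto
          then show False using sum by simp
        qed
        moreover have "?S1 \<noteq> {}"
        proof
          assume "?S1 = {}"
          then have "(\<Sum>z\<in>S. \<alpha> z) = (\<Sum>z\<in>S. 1)" using 01 by (intro sum.cong) auto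
          then show False using sum by (simp add: n_def)
        qed
        moreover have "?S1 \<union> ?S2 = S" "?S1 \<inter> ?S2 = {}" using 01 by auto
        moreover have "?S1 \<subseteq> {x. a \<bullet> x = of_int a0}" "?S2 \<subseteq> {x. a \<bullet> x = of_int a0 + 1}"
          by (auto simp: \<alpha>_def)
        ultimately have "two_partitionable S"
          unfolding two_partitionable_def using a
          by (intro disjI2 exI[of _ ?S1] exI[of _ ?S2] exI[of _ a] exI[of _ a0]) (simp only: simp_thms)
        then show False using S(3) by blast
      qed
      then obtain z0 where z0: "z0 \<in> S" "\<alpha> z0 \<noteq> 0" "\<alpha> z0 \<noteq> 1" by blast
      obtain i where i: "\<alpha> z0 = of_int i" using \<alpha>_int[OF z0(1)] by (elim Ints_cases)
      have "i \<le> -1 \<or> i \<ge> 2" using z0(2,3) i by auto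
      then have z0': "\<alpha> z0 \<le> -1 \<or> \<alpha> z0 \<ge> 2" unfolding i by linarith
      define y where "y = (1/2) *\<^sub>R p + (1/2) *\<^sub>R T z0"
      have yQ: "y \<in> Q" unfolding y_def using p(1) T(1)[OF z0(1)] by (intro convexD[OF Q]) auto
      have "\<alpha> (fst y) = (\<alpha> (fst p) + \<alpha> z0) / 2"
        by (simp add: y_def \<alpha>_def T(2)[OF z0(1)] inner_add_right field_simps)
      then have "\<alpha> (fst y) \<le> 0 \<or> \<alpha> (fst y) \<ge> 1" using z0' slab by auto
      then have yC: "y \<in> ?C" using side[OF yQ] by (auto simp: \<alpha>_def)
      \<comment> \<open>The weights are forced by the target \<open>w\<close>. In \<open>w\<close>
        each \<open>T z\<close> has weight \<open>(2 * n - 1) / (2 * n\<^sup>2)\<close>, of which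
        \<open>y / n\<close> already supplies \<open>1 / (2 * n)\<close> for \<open>z0\<close>,
        together with the whole weight of \<open>p\<close>. Dividing the rest by
        \<open>1 - 1 / n\<close> makes it sum to 1.\<close>
      define d where "d z = (if z = z0 then (n - 1) / (2 * n\<^sup>2) else (2 * n - 1) / (2 * n\<^sup>2)) / (1 - 1 / n)" for z
      have d0: "d z \<ge> 0" for z using n2 by (auto simp: d_def)
      have pull: "(\<Sum>z\<in>S. F z) = F z0 + (\<Sum>z\<in>S - {z0}. F z)" for F :: "real^'m \<Rightarrow> 'v::ab_group_add"
        using S(1) z0(1) by (rule sum.remove)
      have "card (S - {z0}) = card S - 1" using z0(1) by simp
      then have cardS: "real (card (S - {z0})) = n - 1" using n2 by (simp add: n_def of_nat_diff)
      have "(\<Sum>z\<in>S - {z0}. d z) = (n - 1) * ((2 * n - 1) / (2 * n\<^sup>2) / (1 - 1 / n))"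
        using cardS by (simp add: d_def)
      moreover have "(n - 1) / (2 * n\<^sup>2) / (1 - 1 / n) + (n - 1) * ((2 * n - 1) / (2 * n\<^sup>2) / (1 - 1 / n)) = 1"
      proof -
        have e: "1 - 1 / n = (n - 1) / n" "n - 1 \<noteq> 0" "n \<noteq> 0"
          using n2 by (auto simp: diff_divide_distrib)
        have "(n - 1) / (2 * n\<^sup>2) / (1 - 1 / n) = 1 / (2 * n)"
          unfolding e(1) using e(2,3) by (simp add: power2_eq_square)
        moreover have "(n - 1) * ((2 * n - 1) / (2 * n\<^sup>2) / (1 - 1 / n)) = (2 * n - 1) / (2 * n)"
          unfolding e(1) using e(2,3) by (simp add: power2_eq_square)
        ultimately show ?thesis using e(3) by (simp flip: add_divide_distrib)
      qed
      ultimately have d1: "(\<Sum>z\<in>S. d z) = 1" by (simp add: pull d_def cardS)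
      have vC: "(\<Sum>z\<in>S. d z *\<^sub>R T z) \<in> ?C"
        using S(1) TC d0 d1 by (intro convex_sum[OF _ cC]) auto
      have "(1 / n) *\<^sub>R y + (1 - 1 / n) *\<^sub>R (\<Sum>z\<in>S. d z *\<^sub>R T z) \<in> ?C"
        using n2 by (intro convexD[OF cC yC vC]) auto
      also have "(1 / n) *\<^sub>R y + (1 - 1 / n) *\<^sub>R (\<Sum>z\<in>S. d z *\<^sub>R T z) = w"
      proof -
        let ?r = "\<Sum>z\<in>S - {z0}. T z"
        have n1: "1 - 1 / n \<noteq> 0" "n \<noteq> 0" using n2 by auto
        have "(\<Sum>z\<in>S - {z0}. d z *\<^sub>R T z) = ((2 * n - 1) / (2 * n\<^sup>2) / (1 - 1 / n)) *\<^sub>R ?r"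
          by (simp add: d_def scaleR_sum_right)
        then have "(1 - 1 / n) *\<^sub>R (\<Sum>z\<in>S. d z *\<^sub>R T z)
            = ((n - 1) / (2 * n\<^sup>2)) *\<^sub>R T z0 + ((2 * n - 1) / (2 * n\<^sup>2)) *\<^sub>R ?r"
          using n1(1) by (simp add: pull d_def scaleR_add_right)
        moreover have "m = (1 / n) *\<^sub>R T z0 + (1 / n) *\<^sub>R ?r"
          by (simp add: m_def pull scaleR_add_right)
        moreover have "(1 / n) *\<^sub>R y = (1 / (2 * n)) *\<^sub>R p + (1 / (2 * n)) *\<^sub>R T z0"
          by (simp add: y_def scaleR_add_right mult.commute)
        moreover have "(1 - 1 / (2 * n)) * (1 / n) = (2 * n - 1) / (2 * n\<^sup>2)"
          using n1(2) by (simp add: field_simps power2_eq_square)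
        moreover have "(2 * n - 1) / (2 * n\<^sup>2) = (n - 1) / (2 * n\<^sup>2) + 1 / (2 * n)"
          using n1(2) by (simp add: field_simps power2_eq_square)
        then have "((2 * n - 1) / (2 * n\<^sup>2)) *\<^sub>R T z0 = ((n - 1) / (2 * n\<^sup>2)) *\<^sub>R T z0 + (1 / (2 * n)) *\<^sub>R T z0"
          by (metis scaleR_add_left)
        ultimately show ?thesis
          unfolding w_def by (simp only: scaleR_add_right scaleR_scaleR add_ac)
      qed
      finally show ?thesis .
    qed
  qed
  then have "w \<in> split_closure Q"
    by (auto simp: split_closure_def)
  then show ?thesis by (simp add: w_def m_def n_def)
qed

section \<open>The corner relaxation of a lattice-free polytope\<close>

locale lattice_free_cut =
  fixes f :: "real^'m" and r :: "'k::finite \<Rightarrow> real^'m" and L :: "(real^'m) set"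
  assumes r_nz: "r j \<noteq> 0"
    and L_rat: "rational_polytope L" and L_lf: "lattice_free L"
    and f_int: "f \<in> interior L"
begin

definition relaxation :: "((real^'m) \<times> (real^'k)) set" where
  "relaxation = {(x, s). (\<forall>j. s $ j \<ge> 0) \<and> x = f + (\<Sum>j\<in>UNIV. s $ j *\<^sub>R r j)}"

definition gauge_vec :: "real^'k" where
  "gauge_vec = (\<chi> j. gauge L f (r j))"

text \<open>The signed violation of the \<open>L\<close>-cut: positive exactly at the points that
  the cut removes.\<close>

definition slack :: "(real^'m) \<times> (real^'k) \<Rightarrow> real" where
  "slack p = 1 - gauge_vec \<bullet> snd p"

text \<open>Upper bounds on the violation that depend on \<open>x\<close> alone.
  \<open>derivable 0 0\<close> says that the cut has finite rank.\<close>

definition derivable :: "real^'m \<Rightarrow> real \<Rightarrow> bool" where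
  "derivable a b \<longleftrightarrow> (\<exists>t. \<forall>p \<in> (split_closure ^^ t) relaxation. slack p \<le> a \<bullet> fst p + b)"

section \<open>Geometry of \<open>L\<close> and bounds on its gauge\<close>

lemma polytope_L: "polytope L"
  using L_rat by (auto simp: rational_polytope_def polytope_def)

lemma compact_L: "compact L" and convex_L: "convex L" and closed_L: "closed L" and polyhedron_L: "polyhedron L"
  using polytope_L
  by (auto simp: polytope_imp_compact polytope_imp_convex polytope_imp_closed polytope_imp_polyhedron)

lemma f_in_L: "f \<in> L"
  using f_int interior_subset by blast

lemma finite_int_L: "finite (L \<inter> {z. int_vec z})"
  using finite_int_vec_bounded compact_imp_bounded[OF compact_L] by blast

lemma f_strict:
  assumes "a \<noteq> 0" "\<And>x. x \<in> L \<Longrightarrow> a \<bullet> x \<le> b"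
  shows "a \<bullet> f < b"
proof -
  have "interior L \<subseteq> interior {x. a \<bullet> x \<le> b}"
    using assms(2) by (intro interior_mono) auto
  then show ?thesis
    using f_int by (auto simp: interior_halfspace_le[OF assms(1)])
qed

lemma frontier_in_facet:
  assumes "z \<in> L" "z \<notin> interior L"
  obtains G where "G facet_of L" "z \<in> G"
proof -
  have "rel_interior L = interior L"
    using f_int rel_interior_nonempty_interior by blast
  then show thesis
    using assms that rel_boundary_of_polyhedron[OF polyhedron_L] by blast
qed

lemma int_vec_in_facet:
  assumes "z \<in> L" "int_vec z"
  obtains G where "G facet_of L" "z \<in> G"
  using frontier_in_facet assms L_lf by (metis lattice_free_def)

text \<open>\<open>L\<close> contains a ball around \<open>f\<close>. Nonemptiness matters because
  \<open>Inf\<close> of the empty set carries no information.\<close>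

lemma gauge_set_nonempty: "{t. t > 0 \<and> f + (1 / t) *\<^sub>R v \<in> L} \<noteq> {}"
proof -
  obtain e where e: "e > 0" "ball f e \<subseteq> L"
    using f_int by (auto simp: mem_interior)
  define t where "t = (norm v + 1) / e"
  have t: "t > 0" using e(1) by (simp add: t_def add_nonneg_pos)
  have "norm ((1 / t) *\<^sub>R v) < e"
    using t e(1) by (simp add: t_def field_simps add_nonneg_pos)
  then have "f + (1 / t) *\<^sub>R v \<in> ball f e" by (simp add: dist_norm)
  then show ?thesis using t e(2) by blast
qed

lemma gauge_ge:
  assumes "\<And>x. x \<in> L \<Longrightarrow> a \<bullet> x \<le> b" "a \<bullet> f < b"
  shows "a \<bullet> v \<le> gauge L f v * (b - a \<bullet> f)"
proof -
  have "(a \<bullet> v) / (b - a \<bullet> f) \<le> gauge L f v"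
    unfolding gauge_def
  proof (rule cInf_greatest[OF gauge_set_nonempty])
    fix t assume "t \<in> {t. t > 0 \<and> f + (1 / t) *\<^sub>R v \<in> L}"
    then have t: "t > 0" "a \<bullet> (f + (1 / t) *\<^sub>R v) \<le> b" using assms(1) by auto
    then have "(a \<bullet> v) / t \<le> b - a \<bullet> f" by (simp add: inner_add_right)
    then show "(a \<bullet> v) / (b - a \<bullet> f) \<le> t"
      using t(1) assms(2) by (simp add: field_simps)
  qed
  then show ?thesis using assms(2) by (simp add: field_simps)
qed

text \<open>\<open>L\<close> lies in a ball around \<open>f\<close>. The factor 2 leaves half of the
  growth of the gauge to absorb linear terms of norm at most \<open>\<kappa>\<close>.\<close>

lemma gauge_ge_norm:
  obtains \<kappa> where "\<kappa> > 0" "\<And>v. 2 * \<kappa> * norm v \<le> gauge L f v"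
proof -
  obtain B where B: "B > 0" "\<And>x. x \<in> L \<Longrightarrow> norm x \<le> B"
    using compact_imp_bounded[OF compact_L] bounded_pos by blast
  define R where "R = B + norm f"
  have R: "R > 0" using B(1) by (simp add: R_def add_pos_nonneg)
  have "norm v / R \<le> gauge L f v" for v
    unfolding gauge_def
  proof (rule cInf_greatest[OF gauge_set_nonempty])
    fix t assume "t \<in> {t. t > 0 \<and> f + (1 / t) *\<^sub>R v \<in> L}"
    then have t: "t > 0" "norm (f + (1 / t) *\<^sub>R v) \<le> B" using B(2) by auto
    have "norm ((1 / t) *\<^sub>R v) \<le> norm (f + (1 / t) *\<^sub>R v) + norm f"
      by (metis add.commute add_diff_cancel_left' norm_triangle_ineq4)
    then have "norm v / t \<le> R" using t by (simp add: R_def)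
    then show "norm v / R \<le> t" using t(1) R by (simp add: field_simps)
  qed
  then show thesis
    using R by (intro that[of "1 / (2 * R)"]) auto
qed

lemma gauge_le:
  assumes "c > 0" "f + c *\<^sub>R v \<in> L"
  shows "gauge L f v \<le> 1 / c"
  unfolding gauge_def
  by (rule cInf_lower) (use assms in \<open>auto intro!: bdd_belowI[of _ 0]\<close>)

section \<open>The relaxation and the violation of the cut\<close>

lemma relaxationD:
  assumes "p \<in> relaxation"
  shows "snd p $ j \<ge> 0" "fst p = f + (\<Sum>j\<in>UNIV. snd p $ j *\<^sub>R r j)"
  using assms by (auto simp: relaxation_def)

lemma relaxationI:
  assumes "\<And>j. snd p $ j \<ge> 0" "fst p = f + (\<Sum>j\<in>UNIV. snd p $ j *\<^sub>R r j)"
  shows "p \<in> relaxation"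
  using assms by (cases p) (auto simp: relaxation_def)

lemma closed_relaxation: "closed relaxation"
proof -
  have "relaxation = {p. \<forall>j. snd p $ j \<ge> 0} \<inter> {p. fst p = f + (\<Sum>j\<in>UNIV. snd p $ j *\<^sub>R r j)}"
    using relaxationD relaxationI by blast
  moreover have "closed {p :: (real^'m) \<times> (real^'k). \<forall>j. snd p $ j \<ge> 0}"
    by (intro closed_Collect_all closed_Collect_le continuous_intros)
  moreover have "closed {p :: (real^'m) \<times> (real^'k). fst p = f + (\<Sum>j\<in>UNIV. snd p $ j *\<^sub>R r j)}"
    by (intro closed_Collect_eq continuous_intros)
  ultimately show ?thesis by (simp add: closed_Int)
qed

lemma convex_relaxation: "convex relaxation"
proof (rule convexI)
  fix p q :: "(real^'m) \<times> (real^'k)" and u v :: real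
  assume p: "p \<in> relaxation" and q: "q \<in> relaxation" and uv: "u \<ge> 0" "v \<ge> 0" "u + v = 1"
  have "f = u *\<^sub>R f + v *\<^sub>R f" using uv(3) by (metis scaleR_add_left scaleR_one)
  then show "u *\<^sub>R p + v *\<^sub>R q \<in> relaxation"
    using uv relaxationD(1)[OF p] relaxationD(1)[OF q] relaxationD(2)[OF p] relaxationD(2)[OF q]
    by (intro relaxationI)
       (simp_all add: scaleR_add_right scaleR_add_left sum.distrib scaleR_sum_right algebra_simps)
qed

lemma slack_affine:
  "u + v = 1 \<Longrightarrow> slack (u *\<^sub>R p + v *\<^sub>R q) = u * slack p + v * slack q"
proof -
  assume "u + v = 1"
  then have "v = 1 - u" by simp
  then show ?thesis by (simp add: slack_def inner_add_right algebra_simps)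
qed

text \<open>Summing \<open>gauge_ge\<close> over the rays turns a valid inequality of
  \<open>L\<close> into a bound that is 1 at \<open>f\<close> and 0 on the hyperplane of the
  inequality.\<close>

lemma slack_le_valid_inequality:
  assumes p: "p \<in> relaxation" and a: "\<And>x. x \<in> L \<Longrightarrow> a \<bullet> x \<le> b" "a \<bullet> f < b"
  shows "slack p \<le> (b - a \<bullet> fst p) / (b - a \<bullet> f)"
proof -
  have "a \<bullet> (fst p - f) = (\<Sum>j\<in>UNIV. snd p $ j * (a \<bullet> r j))"
    by (subst relaxationD(2)[OF p]) (simp add: inner_sum_right)
  also have "\<dots> \<le> (\<Sum>j\<in>UNIV. snd p $ j * (gauge L f (r j) * (b - a \<bullet> f)))"
    using relaxationD(1)[OF p] gauge_ge[OF a] by (intro sum_mono mult_left_mono) auto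
  also have "\<dots> = (gauge_vec \<bullet> snd p) * (b - a \<bullet> f)"
    unfolding gauge_vec_def inner_vec_def[of _ "snd p"] by (simp add: sum_distrib_left mult_ac)
  finally have "a \<bullet> fst p - a \<bullet> f \<le> (1 - slack p) * (b - a \<bullet> f)"
    by (simp add: slack_def inner_diff_right)
  then have "slack p * (b - a \<bullet> f) \<le> b - a \<bullet> fst p" by (simp add: algebra_simps)
  then show ?thesis using a(2) by (simp add: pos_le_divide_eq)
qed

lemma gauge_vec_ge_norm:
  assumes \<kappa>: "\<And>v. 2 * \<kappa> * norm v \<le> gauge L f v" "\<kappa> > 0" and p: "p \<in> relaxation"
  shows "2 * \<kappa> * norm (fst p - f) \<le> gauge_vec \<bullet> snd p"
proof -
  have "norm (fst p - f) \<le> (\<Sum>j\<in>UNIV. norm (snd p $ j *\<^sub>R r j))"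
    unfolding relaxationD(2)[OF p] add_diff_cancel_left' by (rule norm_sum)
  also have "\<dots> = (\<Sum>j\<in>UNIV. snd p $ j * norm (r j))"
    using relaxationD(1)[OF p] by simp
  finally have "2 * \<kappa> * norm (fst p - f) \<le> 2 * \<kappa> * (\<Sum>j\<in>UNIV. snd p $ j * norm (r j))"
    using \<kappa>(2) by simp
  also have "\<dots> = (\<Sum>j\<in>UNIV. snd p $ j * (2 * \<kappa> * norm (r j)))"
    by (simp add: sum_distrib_left mult_ac)
  also have "\<dots> \<le> (\<Sum>j\<in>UNIV. snd p $ j * gauge L f (r j))"
    using relaxationD(1)[OF p] \<kappa>(1) by (intro sum_mono mult_left_mono) auto
  also have "\<dots> = gauge_vec \<bullet> snd p"
    by (simp add: gauge_vec_def inner_vec_def mult.commute)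
  finally show ?thesis .
qed

section \<open>The violation at integer points, and bounds that are strict there\<close>

lemma slack_int_vec_le_0:
  assumes p: "p \<in> relaxation" and z: "fst p \<in> L" "int_vec (fst p)"
  shows "slack p \<le> 0"
proof -
  obtain G where G: "G facet_of L" "fst p \<in> G" using int_vec_in_facet[OF z] .
  obtain a b where ab: "a \<noteq> 0" "L \<subseteq> {x. a \<bullet> x \<le> b}" "G = L \<inter> {x. a \<bullet> x = b}"
    using facet_of_polyhedron[OF polyhedron_L G(1)] by blast
  then have "a \<bullet> f < b" using f_strict[OF ab(1)] by blast
  then show ?thesis
    using slack_le_valid_inequality[OF p, of a b] ab(2,3) G(2) by auto
qed

text \<open>A hyperplane strictly separating \<open>z\<close> from \<open>L\<close> gives a negative
  bound that is uniform over all points of the relaxation above \<open>z\<close>.\<close>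

lemma slack_outside_neg:
  assumes "z \<notin> L"
  obtains \<eta> where "\<eta> > 0" "\<And>p. p \<in> relaxation \<Longrightarrow> fst p = z \<Longrightarrow> slack p \<le> - \<eta>"
proof -
  obtain a b where ab: "a \<bullet> z < b" "\<And>x. x \<in> L \<Longrightarrow> a \<bullet> x > b"
    using separating_hyperplane_closed_point[OF convex_L closed_L assms] by blast
  have f: "(-a) \<bullet> f < -b" using ab(2)[OF f_in_L] by simp
  have L: "\<And>x. x \<in> L \<Longrightarrow> (-a) \<bullet> x \<le> -b" using ab(2) by (simp add: less_imp_le)
  show thesis
  proof (rule that)
    show "(b - a \<bullet> z) / (a \<bullet> f - b) > 0" using ab(1) f by (simp add: zero_less_divide_iff)
    show "slack p \<le> - ((b - a \<bullet> z) / (a \<bullet> f - b))" if "p \<in> relaxation" "fst p = z" for p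
    proof -
      have "slack p \<le> (a \<bullet> z - b) / (a \<bullet> f - b)"
        using slack_le_valid_inequality[OF that(1) L f] that(2) by (simp add: algebra_simps)
      also have "\<dots> = - ((b - a \<bullet> z) / (a \<bullet> f - b))"
        by (metis minus_diff_eq minus_divide_left)
      finally show ?thesis .
    qed
  qed
qed

text \<open>Near \<open>f\<close> there are only finitely many integer points outside
  \<open>L\<close>, so their negative bounds have a common margin. Far from \<open>f\<close> the
  violation decreases faster than any affine function with small coefficients.\<close>

lemma slack_outside_less_small_affine:
  obtains \<eta> where "\<eta> > 0"
    "\<And>a b p. norm a \<le> \<eta> \<Longrightarrow> \<bar>b\<bar> \<le> \<eta> \<Longrightarrow> p \<in> relaxation \<Longrightarrow> int_vec (fst p) \<Longrightarrow> fst p \<notin> L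
      \<Longrightarrow> slack p < a \<bullet> fst p + b"
proof -
  obtain \<kappa> where \<kappa>: "\<kappa> > 0" "\<And>v. 2 * \<kappa> * norm v \<le> gauge L f v" using gauge_ge_norm by blast
  define N where "N = cball f (2 / \<kappa>) \<inter> {z. int_vec z} - L"
  have "finite N" unfolding N_def using finite_int_vec_bounded[OF bounded_cball] by blast
  have "\<forall>z\<in>N. \<exists>e>0. \<forall>p\<in>relaxation. fst p = z \<longrightarrow> slack p \<le> - e"
    using slack_outside_neg unfolding N_def by (metis DiffD2)
  then obtain e where e: "\<And>z. z \<in> N \<Longrightarrow> e z > 0"
      "\<And>z p. z \<in> N \<Longrightarrow> p \<in> relaxation \<Longrightarrow> fst p = z \<Longrightarrow> slack p \<le> - e z"
    by metis
  define \<delta> where "\<delta> = Min (insert 1 (e ` N))"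
  have \<delta>: "\<delta> > 0" "\<And>z. z \<in> N \<Longrightarrow> \<delta> \<le> e z"
    using \<open>finite N\<close> e(1) by (auto simp: \<delta>_def)
  define C where "C = norm f + 2 / \<kappa> + 1"
  have C: "C > 0" using \<kappa>(1) by (simp add: C_def add_nonneg_pos)
  \<comment> \<open>The bounds \<open>\<kappa>\<close> and \<open>1 / (norm f + 1)\<close> serve the
    far points, where \<open>\<kappa> * norm (?x - f) > 2\<close> pays for all constants. The last
    one keeps the affine function above \<open>-\<delta>\<close> within the radius
    \<open>2 / \<kappa>\<close>.\<close>
  define \<eta> where "\<eta> = min \<kappa> (min (1 / (norm f + 1)) (\<delta> / (2 * C)))"
  have \<eta>: "\<eta> > 0" "\<eta> \<le> \<kappa>" "\<eta> * (norm f + 1) \<le> 1" "\<eta> * C < \<delta>"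
  proof -
    show "\<eta> > 0" using \<kappa>(1) \<delta>(1) C by (auto simp: \<eta>_def add_nonneg_pos)
    show "\<eta> \<le> \<kappa>" by (simp add: \<eta>_def)
    have "\<eta> \<le> 1 / (norm f + 1)" by (simp add: \<eta>_def)
    then show "\<eta> * (norm f + 1) \<le> 1" by (simp add: pos_le_divide_eq add_nonneg_pos)
    have "\<eta> \<le> \<delta> / (2 * C)" by (simp add: \<eta>_def)
    then have "\<eta> * C \<le> \<delta> / 2" using C by (simp add: field_simps)
    then show "\<eta> * C < \<delta>" using \<delta>(1) by simp
  qed
  show thesis
  proof (rule that[OF \<eta>(1)])
    fix a :: "real^'m" and b and p
    assume a: "norm a \<le> \<eta>" and b: "\<bar>b\<bar> \<le> \<eta>" and p: "p \<in> relaxation" and z: "int_vec (fst p)" "fst p \<notin> L"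
    let ?x = "fst p"
    have "- (a \<bullet> f) \<le> norm a * norm f" "- (a \<bullet> (?x - f)) \<le> norm a * norm (?x - f)"
      using Cauchy_Schwarz_ineq2[of a f] Cauchy_Schwarz_ineq2[of a "?x - f"] by linarith+
    moreover have "norm a * norm f \<le> \<eta> * norm f" "norm a * norm (?x - f) \<le> \<eta> * norm (?x - f)"
      using a by (simp_all add: mult_right_mono)
    moreover have "a \<bullet> ?x = a \<bullet> f + a \<bullet> (?x - f)" by (simp add: inner_diff_right)
    ultimately have low: "a \<bullet> ?x + b \<ge> - (\<eta> * norm f) - \<eta> * norm (?x - f) - \<eta>"
      using b by linarith
    show "slack p < a \<bullet> ?x + b"
    proof (cases "norm (?x - f) \<le> 2 / \<kappa>")
      case True
      then have "?x \<in> N" using z by (simp add: N_def dist_norm norm_minus_commute)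
      then have "slack p \<le> - \<delta>" using e(2)[OF _ p refl] \<delta>(2) by force
      moreover have "\<eta> * norm (?x - f) \<le> \<eta> * (2 / \<kappa>)" using True \<eta>(1) by (intro mult_left_mono) auto
      moreover have "\<eta> * C = \<eta> * norm f + \<eta> * (2 / \<kappa>) + \<eta>" by (simp add: C_def distrib_left)
      ultimately show ?thesis using low \<eta>(4) by linarith
    next
      case False
      then have "\<kappa> * norm (?x - f) > 2" using \<kappa>(1) by (simp add: field_simps)
      moreover have "slack p \<le> 1 - 2 * (\<kappa> * norm (?x - f))"
        using gauge_vec_ge_norm[OF \<kappa>(2,1) p] by (simp add: slack_def)
      moreover have "\<eta> * norm (?x - f) \<le> \<kappa> * norm (?x - f)" using \<eta>(2) by (simp add: mult_right_mono)
      moreover have "\<eta> * norm f + \<eta> \<le> 1" using \<eta>(3) by (simp add: distrib_left)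
      ultimately show ?thesis using low by linarith
    qed
  qed
qed

text \<open>This is \<open>split_closure_power_eventually_less\<close> for the functional
  \<open>slack p - a \<bullet> fst p\<close> without its constant term. Its upper level sets are
  bounded since the cut's left-hand side grows at least twice as fast in \<open>x\<close> as
  \<open>a\<close> can.\<close>

lemma derivable_strict_int:
  obtains \<kappa> where "\<kappa> > 0"
    "\<And>a b. norm a \<le> \<kappa> \<Longrightarrow> (\<And>p. p \<in> relaxation \<Longrightarrow> int_vec (fst p) \<Longrightarrow> slack p < a \<bullet> fst p + b)
      \<Longrightarrow> derivable a b"
proof -
  obtain \<kappa> where \<kappa>: "\<kappa> > 0" "\<And>v. 2 * \<kappa> * norm v \<le> gauge L f v" using gauge_ge_norm by blast
  have g_pos: "gauge_vec $ j > 0" for j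
  proof -
    have "0 < 2 * \<kappa> * norm (r j)" using \<kappa>(1) r_nz by simp
    then show ?thesis using \<kappa>(2)[of "r j"] by (simp add: gauge_vec_def)
  qed
  show thesis
  proof (rule that[OF \<kappa>(1)])
    fix a b assume a: "norm a \<le> \<kappa>"
      and int: "\<And>p. p \<in> relaxation \<Longrightarrow> int_vec (fst p) \<Longrightarrow> slack p < a \<bullet> fst p + b"
    define A where "A = (- a, - gauge_vec)"
    have A: "A \<bullet> p = slack p - 1 - a \<bullet> fst p" for p
      by (cases p) (simp add: A_def slack_def)
    have bdd: "bounded (relaxation \<inter> {p. A \<bullet> p \<ge> c})" for c
    proof -
      \<comment> \<open>With \<open>?g\<close> the value of the cut's left-hand side, the hypotheses
        give \<open>?g \<le> - c + \<kappa> * norm f + ?g / 2\<close>; solving for \<open>?g\<close>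
        yields \<open>B\<close>. Positive gauges then bound every coordinate of
        \<open>s\<close>.\<close>
      define B where "B = 2 * (\<kappa> * norm f - c)"
      have "norm p \<le> B / (2 * \<kappa>) + norm f + (\<Sum>j\<in>UNIV. B / gauge_vec $ j)"
        if p: "p \<in> relaxation" and Ap: "A \<bullet> p \<ge> c" for p
      proof -
        let ?g = "gauge_vec \<bullet> snd p"
        have n: "2 * \<kappa> * norm (fst p - f) \<le> ?g" by (rule gauge_vec_ge_norm[OF \<kappa>(2,1) p])
        then have n': "2 * (\<kappa> * norm (fst p - f)) \<le> ?g" by simp
        have "- (a \<bullet> f) \<le> norm a * norm f" "- (a \<bullet> (fst p - f)) \<le> norm a * norm (fst p - f)"
          using Cauchy_Schwarz_ineq2[of a f] Cauchy_Schwarz_ineq2[of a "fst p - f"] by linarith+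
        moreover have "norm a * norm f \<le> \<kappa> * norm f" "norm a * norm (fst p - f) \<le> \<kappa> * norm (fst p - f)"
          using a by (simp_all add: mult_right_mono)
        moreover have "a \<bullet> fst p = a \<bullet> f + a \<bullet> (fst p - f)" by (simp add: inner_diff_right)
        ultimately have "- (a \<bullet> fst p) \<le> \<kappa> * norm f + \<kappa> * norm (fst p - f)" by linarith
        moreover have "?g \<le> - c - a \<bullet> fst p" using Ap by (simp add: A slack_def)
        moreover have "B = 2 * (\<kappa> * norm f) - 2 * c" by (simp add: B_def)
        ultimately have gB: "?g \<le> B" using n' by linarith
        then have "norm (fst p - f) \<le> B / (2 * \<kappa>)" using n \<kappa>(1) by (simp add: field_simps)
        then have 1: "norm (fst p) \<le> B / (2 * \<kappa>) + norm f"
          using norm_triangle_ineq2[of "fst p" f] by linarith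
        have "\<bar>snd p $ j\<bar> \<le> B / gauge_vec $ j" for j
        proof -
          have "gauge_vec $ j * snd p $ j \<le> (\<Sum>j\<in>UNIV. gauge_vec $ j * snd p $ j)"
            using g_pos relaxationD(1)[OF p] by (intro member_le_sum) (auto simp: less_imp_le)
          then have "gauge_vec $ j * snd p $ j \<le> B" using gB by (simp add: inner_vec_def)
          then show ?thesis using g_pos[of j] relaxationD(1)[OF p, of j] by (simp add: field_simps)
        qed
        then have "(\<Sum>j\<in>UNIV. \<bar>snd p $ j\<bar>) \<le> (\<Sum>j\<in>UNIV. B / gauge_vec $ j)" by (intro sum_mono)
        then have "norm (snd p) \<le> (\<Sum>j\<in>UNIV. B / gauge_vec $ j)"
          using norm_le_l1_cart[of "snd p"] by linarith
        moreover have "norm p \<le> norm (fst p) + norm (snd p)"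
          using norm_Pair_le[of "fst p" "snd p"] by simp
        ultimately show ?thesis using 1 by linarith
      qed
      then show ?thesis unfolding bounded_iff by blast
    qed
    have "A \<bullet> p < b - 1" if "p \<in> relaxation" "int_vec (fst p)" for p
      using int[OF that] by (simp add: A)
    then obtain t where t: "\<And>p. p \<in> (split_closure ^^ t) relaxation \<Longrightarrow> A \<bullet> p < b - 1"
      using split_closure_power_eventually_less[OF closed_relaxation convex_relaxation bdd] by metis
    have "slack p \<le> a \<bullet> fst p + b" if "p \<in> (split_closure ^^ t) relaxation" for p
      using t[OF that] unfolding A by linarith
    then show "derivable a b" unfolding derivable_def by blast
  qed
qed


section \<open>Combining derivable bounds\<close>

lemma derivable_cases:
  assumes "derivable a1 b1" "derivable a2 b2"
    and le: "\<And>x. a1 \<bullet> x + b1 \<le> a \<bullet> x + b \<or> a2 \<bullet> x + b2 \<le> a \<bullet> x + b"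
  shows "derivable a b"
proof -
  obtain t1 t2 where t: "\<And>p. p \<in> (split_closure ^^ t1) relaxation \<Longrightarrow> slack p \<le> a1 \<bullet> fst p + b1"
    "\<And>p. p \<in> (split_closure ^^ t2) relaxation \<Longrightarrow> slack p \<le> a2 \<bullet> fst p + b2"
    using assms(1,2) by (auto simp: derivable_def)
  have "slack p \<le> a \<bullet> fst p + b" if p: "p \<in> (split_closure ^^ (max t1 t2)) relaxation" for p
    using t(1)[of p] t(2)[of p] le[of "fst p"] p
      split_closure_power_antimono[OF convex_relaxation, of t1 "max t1 t2"]
      split_closure_power_antimono[OF convex_relaxation, of t2 "max t1 t2"] by force
  then show ?thesis unfolding derivable_def by blast
qed

text \<open>On the later of the two closures both bounds hold, so each side of the split lies in the
  half-space of the claim, and so does the convex hull of the two sides.\<close>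

lemma derivable_split:
  assumes D: "derivable a1 b1" "derivable a2 b2" and \<pi>: "int_vec \<pi>"
    and le1: "\<And>x. \<pi> \<bullet> x \<le> of_int \<pi>0 \<Longrightarrow> a1 \<bullet> x + b1 \<le> a \<bullet> x + b"
    and le2: "\<And>x. \<pi> \<bullet> x \<ge> of_int \<pi>0 + 1 \<Longrightarrow> a2 \<bullet> x + b2 \<le> a \<bullet> x + b"
  shows "derivable a b"
proof -
  obtain t1 t2 where t: "\<And>p. p \<in> (split_closure ^^ t1) relaxation \<Longrightarrow> slack p \<le> a1 \<bullet> fst p + b1"
    "\<And>p. p \<in> (split_closure ^^ t2) relaxation \<Longrightarrow> slack p \<le> a2 \<bullet> fst p + b2"
    using D by (auto simp: derivable_def)
  define Q where "Q = (split_closure ^^ (max t1 t2)) relaxation"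
  have Q: "slack p \<le> a1 \<bullet> fst p + b1" "slack p \<le> a2 \<bullet> fst p + b2" if "p \<in> Q" for p
    using t[of p] that split_closure_power_antimono[OF convex_relaxation, of t1 "max t1 t2"]
      split_closure_power_antimono[OF convex_relaxation, of t2 "max t1 t2"] by (auto simp: Q_def)
  have half: "{p. slack p \<le> a \<bullet> fst p + b} = {p. (- a, - gauge_vec) \<bullet> p \<le> b - 1}"
    by (auto simp: slack_def inner_prod_def)
  have "split_disj \<pi> \<pi>0 Q \<subseteq> {p. slack p \<le> a \<bullet> fst p + b}"
    unfolding split_disj_def
  proof (rule hull_minimal)
    show "convex {p. slack p \<le> a \<bullet> fst p + b}"
      unfolding half by (rule convex_halfspace_le)
  qed (use Q le1 le2 in \<open>force+\<close>)
  then have "\<forall>p \<in> (split_closure ^^ (Suc (max t1 t2))) relaxation. slack p \<le> a \<bullet> fst p + b"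
    using split_closure_subset_split_disj[OF \<pi>, of Q \<pi>0] by (auto simp: Q_def)
  then show ?thesis unfolding derivable_def by blast
qed

text \<open>With \<open>G = L \<inter> {x. g \<bullet> x = g0}\<close>, the facet inequality bounds the slack by \<open>cG * (g0 - g \<bullet> x)\<close>.
  For \<open>c = cG / M\<close> this implies the claim on one side of the split \<open>\<pi> - M g\<close>; on the other side
  \<open>L\<close> has no integer point with \<open>\<pi> \<bullet> x = \<pi>0\<close>, so the claim holds there with room to spare.\<close>

lemma derivable_facet:
  assumes \<pi>: "int_vec \<pi>"
    and le: "\<And>z. z \<in> L \<Longrightarrow> int_vec z \<Longrightarrow> \<pi> \<bullet> z \<le> of_int \<pi>0"
    and z1: "z1 \<in> L" "int_vec z1" "\<pi> \<bullet> z1 = of_int \<pi>0"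
    and G: "G facet_of L" "\<And>z. z \<in> L \<Longrightarrow> int_vec z \<Longrightarrow> \<pi> \<bullet> z = of_int \<pi>0 \<Longrightarrow> z \<in> G"
  obtains c0 where "c0 > 0" "\<And>c. 0 < c \<Longrightarrow> c \<le> c0 \<Longrightarrow> derivable (- (c *\<^sub>R \<pi>)) (c * of_int \<pi>0)"
proof -
  obtain g b where g: "int_vec g" "g \<noteq> 0" "\<And>x. x \<in> L \<Longrightarrow> g \<bullet> x \<le> b" "G = L \<inter> {x. g \<bullet> x = b}"
    using rational_polytope_facet_int_normal[OF L_rat _ G(1)] f_int by blast
  have "g \<bullet> z1 = b" using G(2)[OF z1] g(4) by blast
  then obtain g0 where g0: "b = of_int g0"
    using inner_int_vec[OF g(1) z1(2)] by (metis Ints_cases)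
  have gf: "g \<bullet> f < b" using f_strict[OF g(2,3)] .
  define cG where "cG = 1 / (b - g \<bullet> f)"
  have cG: "cG > 0" using gf by (simp add: cG_def)
  have der_g: "derivable (- (cG *\<^sub>R g)) (cG * of_int g0)"
    unfolding derivable_def
  proof (intro exI[of _ 0] ballI)
    fix p assume "p \<in> (split_closure ^^ 0) relaxation"
    then have "slack p \<le> (b - g \<bullet> fst p) / (b - g \<bullet> f)"
      using slack_le_valid_inequality[OF _ g(3) gf] by simp
    then show "slack p \<le> - (cG *\<^sub>R g) \<bullet> fst p + cG * of_int g0"
      by (simp add: cG_def g0 diff_divide_distrib)
  qed
  obtain \<eta>1 where \<eta>1: "\<eta>1 > 0"
    "\<And>a b p. norm a \<le> \<eta>1 \<Longrightarrow> \<bar>b\<bar> \<le> \<eta>1 \<Longrightarrow> p \<in> relaxation \<Longrightarrow> int_vec (fst p) \<Longrightarrow> fst p \<notin> L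
      \<Longrightarrow> slack p < a \<bullet> fst p + b"
    using slack_outside_less_small_affine by blast
  obtain \<eta>2 where \<eta>2: "\<eta>2 > 0"
    "\<And>a b. norm a \<le> \<eta>2 \<Longrightarrow> (\<And>p. p \<in> relaxation \<Longrightarrow> int_vec (fst p) \<Longrightarrow> slack p < a \<bullet> fst p + b)
      \<Longrightarrow> derivable a b"
    using derivable_strict_int by blast
  define \<eta> where "\<eta> = min \<eta>1 \<eta>2"
  have \<eta>: "\<eta> > 0" "\<eta> \<le> \<eta>1" "\<eta> \<le> \<eta>2" using \<eta>1(1) \<eta>2(1) by (auto simp: \<eta>_def)
  have der: "derivable (- (c *\<^sub>R \<pi>)) (c * of_int \<pi>0)"
    if M: "M > 0" and c: "c = cG / real M" and small: "c * norm \<pi> \<le> \<eta> / 2" "c * \<bar>of_int \<pi>0\<bar> \<le> \<eta> / 2"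
    for M :: nat and c
  proof -
    have c0: "c > 0" using M cG c by simp
    define u where "u = \<pi> - real M *\<^sub>R g"
    define u0 where "u0 = \<pi>0 - int M * g0"
    have u: "int_vec u"
      using \<pi> g(1) by (auto simp: int_vec_def u_def intro!: Ints_diff Ints_mult)
    have u_eq: "u \<bullet> x - of_int u0 = (\<pi> \<bullet> x - of_int \<pi>0) - real M * (g \<bullet> x - of_int g0)" for x
      by (simp add: u_def u0_def inner_diff_left algebra_simps)
    obtain U where U: "U \<ge> 0" "\<And>z. z \<in> L \<Longrightarrow> int_vec z \<Longrightarrow> \<bar>u \<bullet> z - of_int u0\<bar> \<le> U"
    proof
      let ?U = "Max (insert 0 ((\<lambda>z. \<bar>u \<bullet> z - of_int u0\<bar>) ` (L \<inter> {z. int_vec z})))"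
      show "0 \<le> ?U" using finite_int_L by (intro Max_ge) auto
      show "\<bar>u \<bullet> z - of_int u0\<bar> \<le> ?U" if "z \<in> L" "int_vec z" for z
        using finite_int_L that by (intro Max_ge) auto
    qed
    define B where "B = norm u + \<bar>of_int u0\<bar> + 1"
    have B: "B > 0" by (simp add: B_def add_nonneg_pos)
    \<comment> \<open>The first term keeps the coefficients of the new bound within
      \<open>\<eta>\<close>. The second ensures that a drop of \<open>c\<close>, which occurs where
      \<open>\<pi> \<bullet> z \<le> \<pi>0 - 1\<close>, outweighs the perturbation on the integer
      points of \<open>L\<close>.\<close>
    define \<delta> where "\<delta> = min (\<eta> / (2 * B)) (c / (U + 1))"
    have \<delta>: "\<delta> > 0" using \<eta>(1) B c0 U(1) by (simp add: \<delta>_def)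
    have "\<delta> \<le> \<eta> / (2 * B)" by (simp add: \<delta>_def)
    then have \<delta>B: "\<delta> * B \<le> \<eta> / 2" using B by (simp add: field_simps)
    have "\<delta> \<le> c / (U + 1)" by (simp add: \<delta>_def)
    then have \<delta>U: "\<delta> * U + \<delta> \<le> c" using U(1) by (simp add: field_simps)
    have "\<delta> * B = \<delta> * norm u + \<delta> * \<bar>of_int u0\<bar> + \<delta>" by (simp add: B_def distrib_left)
    moreover have "\<delta> * norm u \<ge> 0" "\<delta> * \<bar>of_int u0\<bar> \<ge> 0" using \<delta> by auto
    ultimately have \<delta>u: "\<delta> * norm u \<le> \<eta> / 2" "\<delta> * \<bar>of_int u0\<bar> + \<delta> \<le> \<eta> / 2"
      using \<delta>B \<delta> by linarith+
    \<comment> \<open>The claimed bound is tilted by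
      \<open>- \<delta> * (u \<bullet> x - u0)\<close> and raised by \<open>\<delta> / 2\<close>.
      The raise makes it strictly positive at the integer points of \<open>L\<close>, yet for
      \<open>u \<bullet> x \<ge> u0 + 1\<close> the tilt brings it below the claim.\<close>
    define a where "a = - (c *\<^sub>R \<pi>) - \<delta> *\<^sub>R u"
    define b' where "b' = c * of_int \<pi>0 + \<delta> * (of_int u0 + 1 / 2)"
    have l_eq: "a \<bullet> x + b' = - c * (\<pi> \<bullet> x - of_int \<pi>0) - \<delta> * (u \<bullet> x - of_int u0) + \<delta> / 2" for x
      by (simp add: a_def b'_def inner_diff_left algebra_simps)
    have "norm a \<le> norm (c *\<^sub>R \<pi>) + norm (\<delta> *\<^sub>R u)"
      unfolding a_def using norm_triangle_ineq4[of "- (c *\<^sub>R \<pi>)" "\<delta> *\<^sub>R u"] by simp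
    then have na: "norm a \<le> \<eta>" using small(1) \<delta>u(1) c0 \<delta> by simp
    have "\<bar>b'\<bar> \<le> \<bar>c * of_int \<pi>0\<bar> + \<bar>\<delta> * of_int u0\<bar> + \<bar>\<delta> * (1 / 2)\<bar>"
      unfolding b'_def distrib_left by linarith
    then have nb: "\<bar>b'\<bar> \<le> \<eta>" using small(2) \<delta>u(2) c0 \<delta> by (simp add: abs_mult)
    have "derivable a b'"
    proof (rule \<eta>2(2))
      show "norm a \<le> \<eta>2" using na \<eta>(3) by simp
      fix p assume p: "p \<in> relaxation" and z: "int_vec (fst p)"
      show "slack p < a \<bullet> fst p + b'"
      proof (cases "fst p \<in> L")
        case False
        then show ?thesis using \<eta>1(2)[OF _ _ p z] na nb \<eta>(2) by simp
      next
        case True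
        have s0: "slack p \<le> 0" by (rule slack_int_vec_le_0[OF p True z])
        obtain i where i: "u \<bullet> fst p = of_int i" using inner_int_vec[OF u z] by (metis Ints_cases)
        obtain j where j: "\<pi> \<bullet> fst p = of_int j" using inner_int_vec[OF \<pi> z] by (metis Ints_cases)
        have jle: "j \<le> \<pi>0" using le[OF True z] j by simp
        show ?thesis
        proof (cases "i \<le> u0")
          case True
          have "- c * (\<pi> \<bullet> fst p - of_int \<pi>0) \<ge> 0"
            using c0 jle j by (simp add: mult_le_0_iff)
          moreover have "- \<delta> * (u \<bullet> fst p - of_int u0) \<ge> 0"
            using \<delta> True i by (simp add: mult_le_0_iff)
          ultimately show ?thesis using s0 \<delta> unfolding l_eq by linarith
        next
          case False
          have "j \<noteq> \<pi>0"
          proof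
            assume "j = \<pi>0"
            then have "fst p \<in> G" using G(2)[OF True z] j by simp
            then have "u \<bullet> fst p - of_int u0 = 0" unfolding u_eq using \<open>j = \<pi>0\<close> j g(4) g0 by simp
            then show False using False i by simp
          qed
          then have "real_of_int j \<le> of_int \<pi>0 - 1" using jle by linarith
          then have "c * 1 \<le> c * (of_int \<pi>0 - \<pi> \<bullet> fst p)" using c0 j by (intro mult_left_mono) auto
          moreover have "\<delta> * (u \<bullet> fst p - of_int u0) \<le> \<delta> * U"
            using U(2)[OF True z] \<delta> by (intro mult_left_mono) auto
          moreover have "- c * (\<pi> \<bullet> fst p - of_int \<pi>0) = c * (of_int \<pi>0 - \<pi> \<bullet> fst p)"
            by (simp add: algebra_simps)
          ultimately show ?thesis using s0 \<delta> \<delta>U unfolding l_eq by linarith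
        qed
      qed
    qed
    from der_g this u show ?thesis
    proof (rule derivable_split)
      fix x assume "u \<bullet> x \<le> of_int u0"
      then have "(\<pi> \<bullet> x - of_int \<pi>0) \<le> real M * (g \<bullet> x - of_int g0)" using u_eq[of x] by linarith
      then have "c * (\<pi> \<bullet> x - of_int \<pi>0) \<le> c * (real M * (g \<bullet> x - of_int g0))"
        using c0 by (intro mult_left_mono) auto
      also have "\<dots> = cG * (g \<bullet> x - of_int g0)" using c M by simp
      finally show "- (cG *\<^sub>R g) \<bullet> x + cG * of_int g0 \<le> - (c *\<^sub>R \<pi>) \<bullet> x + c * of_int \<pi>0"
        by (simp add: algebra_simps)
    next
      fix x assume "u \<bullet> x \<ge> of_int u0 + 1"
      then have "\<delta> * 1 \<le> \<delta> * (u \<bullet> x - of_int u0)" using \<delta> by (intro mult_left_mono) auto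
      then have "a \<bullet> x + b' \<le> - c * (\<pi> \<bullet> x - of_int \<pi>0)" unfolding l_eq using \<delta> by linarith
      then show "a \<bullet> x + b' \<le> - (c *\<^sub>R \<pi>) \<bullet> x + c * of_int \<pi>0" by (simp add: algebra_simps)
    qed
  qed
  define K where "K = norm \<pi> + \<bar>of_int \<pi>0\<bar> + 1"
  have K: "K > 0" by (simp add: K_def add_nonneg_pos)
  define \<epsilon> where "\<epsilon> = \<eta> / (2 * K)"
  have \<epsilon>: "\<epsilon> > 0" using \<eta>(1) K by (simp add: \<epsilon>_def)
  have der': "derivable (- (c *\<^sub>R \<pi>)) (c * of_int \<pi>0)"
    if M: "M > 0" and c: "c = cG / real M" and small: "c \<le> \<epsilon>" for M :: nat and c
  proof (rule der[OF M c])
    have c0: "c > 0" using M cG c by simp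
    have "c * K \<le> \<eta> / 2" using small K by (simp add: \<epsilon>_def field_simps)
    moreover have "c * K = c * norm \<pi> + c * \<bar>of_int \<pi>0\<bar> + c" by (simp add: K_def distrib_left)
    moreover have "c * norm \<pi> \<ge> 0" "c * \<bar>of_int \<pi>0\<bar> \<ge> 0" using c0 by auto
    ultimately show "c * norm \<pi> \<le> \<eta> / 2" "c * \<bar>of_int \<pi>0\<bar> \<le> \<eta> / 2" using c0 by linarith+
  qed
  have ex_M: "\<exists>M::nat. M > 0 \<and> cG / real M \<le> e" if "e > 0" for e
  proof -
    obtain M :: nat where "cG / e < real M" using reals_Archimedean2 by blast
    moreover have "0 < cG / e" using cG that by simp
    ultimately have M: "0 < real M" by linarith
    moreover have "cG \<le> e * real M" using \<open>cG / e < real M\<close> that by (simp add: field_simps)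
    ultimately have "0 < real M" "cG / real M \<le> e" by (auto simp: divide_le_eq)
    then show ?thesis by (intro exI[of _ M]) auto
  qed
  obtain M1 :: nat where M1: "M1 > 0" "cG / real M1 \<le> \<epsilon>" using ex_M[OF \<epsilon>] by blast
  show thesis
  proof (rule that)
    show "cG / real M1 > 0" using cG M1(1) by simp
    fix c assume c: "0 < c" "c \<le> cG / real M1"
    obtain M2 :: nat where M2: "M2 > 0" "cG / real M2 \<le> c" using ex_M[OF c(1)] by blast
    have "cG / real M2 \<le> \<epsilon>" using M1(2) M2(2) c(2) by linarith
    from der'[OF M1(1) refl M1(2)] der'[OF M2(1) refl this]
    \<comment> \<open>A general \<open>c\<close> lies between two constants of the form
      \<open>cG / M\<close>. The smaller one implies the claim where
      \<open>\<pi>0 - \<pi> \<bullet> x\<close> is nonnegative, the larger one where it is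
      negative.\<close>
    show "derivable (- (c *\<^sub>R \<pi>)) (c * of_int \<pi>0)"
    proof (rule derivable_cases)
      fix x
      define y where "y = of_int \<pi>0 - \<pi> \<bullet> x"
      have e: "- (d *\<^sub>R \<pi>) \<bullet> x + d * of_int \<pi>0 = d * y" for d by (simp add: y_def algebra_simps)
      have "(cG / real M1) * y \<le> c * y \<or> (cG / real M2) * y \<le> c * y"
      proof (cases "y \<ge> 0")
        case True
        then show ?thesis using mult_right_mono[OF M2(2)] by blast
      next
        case False
        then show ?thesis using mult_right_mono_neg[OF c(2), of y] by auto
      qed
      then show "- ((cG / real M1) *\<^sub>R \<pi>) \<bullet> x + (cG / real M1) * of_int \<pi>0 \<le> - (c *\<^sub>R \<pi>) \<bullet> x + c * of_int \<pi>0
        \<or> - ((cG / real M2) *\<^sub>R \<pi>) \<bullet> x + (cG / real M2) * of_int \<pi>0 \<le> - (c *\<^sub>R \<pi>) \<bullet> x + c * of_int \<pi>0"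
        unfolding e .
    qed
  qed
qed


section \<open>Bounds for exposed faces of the integer hull\<close>

lemma int_hull_int_vec: "int_hull L \<inter> {z. int_vec z} = L \<inter> {z. int_vec z}"
proof -
  have "int_hull L \<subseteq> L"
    unfolding int_hull_def using convex_L by (intro hull_minimal) auto
  moreover have "L \<inter> {z. int_vec z} \<subseteq> int_hull L"
    unfolding int_hull_def by (rule hull_subset)
  ultimately show ?thesis by blast
qed

text \<open>Perturbing a large multiple of \<open>\<pi>\<close> by the partitioning functional \<open>\<sigma>\<close> exposes either part
  of the face; the two resulting bounds agree with the claim on the two sides of \<open>\<sigma>\<close>.\<close>

lemma derivable_exposed_face:
  assumes two_hyp: "two_hyperplane_property L" and \<pi>: "int_vec \<pi>"
    and le: "\<And>z. z \<in> L \<Longrightarrow> int_vec z \<Longrightarrow> \<pi> \<bullet> z \<le> of_int \<pi>0"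
    and z1: "z1 \<in> L" "int_vec z1" "\<pi> \<bullet> z1 = of_int \<pi>0"
  shows "\<exists>c0>0. \<forall>c. 0 < c \<longrightarrow> c \<le> c0 \<longrightarrow> derivable (- (c *\<^sub>R \<pi>)) (c * of_int \<pi>0)"
  using \<pi> le z1
proof (induction "card {z\<in>L. int_vec z \<and> \<pi> \<bullet> z = of_int \<pi>0}" arbitrary: \<pi> \<pi>0 z1 rule: less_induct)
  case less
  note \<pi> = less.prems(1) and le = less.prems(2) and z1 = less.prems(3-5)
  define S where "S = {z\<in>L. int_vec z \<and> \<pi> \<bullet> z = of_int \<pi>0}"
  have finS: "finite S" by (rule finite_subset[OF _ finite_int_L]) (auto simp: S_def)
  have z1S: "z1 \<in> S" using z1 by (simp add: S_def)
  let ?Z = "L \<inter> {z. int_vec z}"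
  let ?claim = "\<exists>c0>0. \<forall>c. 0 < c \<longrightarrow> c \<le> c0 \<longrightarrow> derivable (- (c *\<^sub>R \<pi>)) (c * of_int \<pi>0)"
  have facet: ?claim if G: "G facet_of L" "S \<subseteq> G" for G
  proof -
    have "\<And>z. z \<in> L \<Longrightarrow> int_vec z \<Longrightarrow> \<pi> \<bullet> z = of_int \<pi>0 \<Longrightarrow> z \<in> G"
      using G(2) by (auto simp: S_def)
    with derivable_facet[OF \<pi> le z1 G(1)] show ?thesis by metis
  qed
  have split: ?claim
    if S12: "S1 \<noteq> {}" "S2 \<noteq> {}" "S1 \<union> S2 = S" and \<sigma>: "int_vec \<sigma>"
      and S1: "S1 \<subseteq> {x. \<sigma> \<bullet> x = of_int \<sigma>0}" and S2: "S2 \<subseteq> {x. \<sigma> \<bullet> x = of_int \<sigma>0 + 1}"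
    for S1 S2 \<sigma> and \<sigma>0 :: int
  proof -
    have "finite ((\<lambda>z. \<bar>\<sigma> \<bullet> z - of_int \<sigma>0\<bar>) ` ?Z)" using finite_int_L by simp
    then obtain K where K: "\<And>z. z \<in> L \<Longrightarrow> int_vec z \<Longrightarrow> \<bar>\<sigma> \<bullet> z - of_int \<sigma>0\<bar> \<le> K"
      by (metis (no_types, lifting) Max_ge IntI imageI mem_Collect_eq)
    \<comment> \<open>Integrality gives \<open>\<pi> \<bullet> z \<le> \<pi>0 - 1\<close> off the
      face, so with \<open>N > K + 1\<close> the drop of \<open>N * \<pi>\<close> exceeds any change
      of \<open>\<sigma>\<close> on the integer points by more than 1. The extra 1 covers the shift
      in \<open>b0\<close>.\<close>
    obtain N :: nat where "K + 1 < real N" using reals_Archimedean2 by blast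
    moreover have "K \<ge> 0" using K[OF z1(1,2)] by linarith
    ultimately have N: "real N > K + 1" "real N > 0" by linarith+
    have caseZ: "(\<pi> \<bullet> z = of_int \<pi>0 \<and> z \<in> S1 \<and> \<sigma> \<bullet> z = of_int \<sigma>0) \<or>
        (\<pi> \<bullet> z = of_int \<pi>0 \<and> z \<in> S2 \<and> \<sigma> \<bullet> z = of_int \<sigma>0 + 1) \<or>
        (z \<notin> S \<and> real N * (\<pi> \<bullet> z - of_int \<pi>0) < - 1 - \<bar>\<sigma> \<bullet> z - of_int \<sigma>0\<bar>)"
      if z: "z \<in> L" "int_vec z" for z
    proof (cases "z \<in> S")
      case True
      then show ?thesis using S12(3) S1 S2 by (auto simp: S_def)
    next
      case False
      obtain j where j: "\<pi> \<bullet> z = of_int j" using inner_int_vec[OF \<pi> z(2)] by (metis Ints_cases)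
      have "j \<noteq> \<pi>0" using False j z by (auto simp: S_def)
      moreover have "j \<le> \<pi>0" using le[OF z] j by simp
      ultimately have "\<pi> \<bullet> z - of_int \<pi>0 \<le> - 1" unfolding j by linarith
      then have "real N * (\<pi> \<bullet> z - of_int \<pi>0) \<le> real N * (-1)" by (intro mult_left_mono) auto
      then show ?thesis using False N(1) K[OF z] by auto
    qed
    have IH: "\<exists>c0>0. \<forall>c. 0 < c \<longrightarrow> c \<le> c0 \<longrightarrow> derivable (- (c *\<^sub>R \<pi>')) (c * of_int \<pi>0')"
      if \<pi>': "int_vec \<pi>'" and le': "\<And>z. z \<in> L \<Longrightarrow> int_vec z \<Longrightarrow> \<pi>' \<bullet> z \<le> of_int \<pi>0'"
        and eq: "\<And>z. z \<in> L \<Longrightarrow> int_vec z \<Longrightarrow> \<pi>' \<bullet> z = of_int \<pi>0' \<Longrightarrow> z \<in> S'"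
        and ne: "z' \<in> S" "\<pi>' \<bullet> z' = of_int \<pi>0'" and ss: "S' \<subseteq> S" "z'' \<in> S" "z'' \<notin> S'"
      for \<pi>' \<pi>0' S' z' z''
    proof (rule less.hyps[OF _ \<pi>' le' _ _ ne(2)])
      have "{z \<in> L. int_vec z \<and> \<pi>' \<bullet> z = of_int \<pi>0'} \<subset> S" using eq ss by blast
      then show "card {z \<in> L. int_vec z \<and> \<pi>' \<bullet> z = of_int \<pi>0'} < card {z \<in> L. int_vec z \<and> \<pi> \<bullet> z = of_int \<pi>0}"
        unfolding S_def[symmetric] by (rule psubset_card_mono[OF finS])
      show "z' \<in> L" "int_vec z'" using ne(1) by (auto simp: S_def)
    qed
    obtain y1 y2 where y: "y1 \<in> S1" "y2 \<in> S2" using S12 by blast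
    have yS: "y1 \<in> S" "y2 \<in> S" "\<pi> \<bullet> y1 = of_int \<pi>0" "\<pi> \<bullet> y2 = of_int \<pi>0"
      using y S12(3) by (auto simp: S_def)
    have disj: "y1 \<notin> S2" "y2 \<notin> S1" using subsetD[OF S1] subsetD[OF S2] y by force+
    \<comment> \<open>Among the integer points of \<open>L\<close>, \<open>\<pi>a\<close> attains
      its maximum \<open>a0\<close> exactly on \<open>S1\<close>, and \<open>\<pi>b\<close> its
      maximum \<open>b0\<close> exactly on \<open>S2\<close>. Both sets are proper subsets of
      \<open>S\<close>, so the induction hypothesis applies.\<close>
    define \<pi>a where "\<pi>a = real N *\<^sub>R \<pi> - \<sigma>"
    define a0 where "a0 = int N * \<pi>0 - \<sigma>0"
    define \<pi>b where "\<pi>b = real N *\<^sub>R \<pi> + \<sigma>"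
    define b0 where "b0 = int N * \<pi>0 + \<sigma>0 + 1"
    have a_eq: "\<pi>a \<bullet> z - of_int a0 = real N * (\<pi> \<bullet> z - of_int \<pi>0) - (\<sigma> \<bullet> z - of_int \<sigma>0)" for z
      by (simp add: \<pi>a_def a0_def inner_diff_left algebra_simps)
    have b_eq: "\<pi>b \<bullet> z - of_int b0 = real N * (\<pi> \<bullet> z - of_int \<pi>0) + (\<sigma> \<bullet> z - of_int \<sigma>0) - 1" for z
      by (simp add: \<pi>b_def b0_def inner_add_left algebra_simps)
    have ints: "int_vec \<pi>a" "int_vec \<pi>b"
      using \<pi> \<sigma> by (auto simp: int_vec_def \<pi>a_def \<pi>b_def intro!: Ints_diff Ints_add Ints_mult)
    have "\<exists>c0>0. \<forall>c. 0 < c \<longrightarrow> c \<le> c0 \<longrightarrow> derivable (- (c *\<^sub>R \<pi>a)) (c * of_int a0)"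
    proof (rule IH[OF ints(1)])
      fix z assume z: "z \<in> L" "int_vec z"
      show "\<pi>a \<bullet> z \<le> of_int a0"
        using caseZ[OF z] a_eq[of z] by auto
      show "z \<in> S1" if "\<pi>a \<bullet> z = of_int a0"
        using caseZ[OF z] a_eq[of z] that by auto
    next
      show "\<pi>a \<bullet> y1 = of_int a0" using a_eq[of y1] y(1) S1 yS(3) by auto
    qed (use yS disj S12(3) in auto)
    then obtain ca where ca: "ca > 0" "\<And>c. 0 < c \<Longrightarrow> c \<le> ca \<Longrightarrow> derivable (- (c *\<^sub>R \<pi>a)) (c * of_int a0)"
      by blast
    have "\<exists>c0>0. \<forall>c. 0 < c \<longrightarrow> c \<le> c0 \<longrightarrow> derivable (- (c *\<^sub>R \<pi>b)) (c * of_int b0)"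
    proof (rule IH[OF ints(2)])
      fix z assume z: "z \<in> L" "int_vec z"
      show "\<pi>b \<bullet> z \<le> of_int b0"
        using caseZ[OF z] b_eq[of z] by auto
      show "z \<in> S2" if "\<pi>b \<bullet> z = of_int b0"
        using caseZ[OF z] b_eq[of z] that by auto
    next
      show "\<pi>b \<bullet> y2 = of_int b0" using b_eq[of y2] y(2) S2 yS(4) by auto
    qed (use yS disj S12(3) in auto)
    then obtain cb where cb: "cb > 0" "\<And>c. 0 < c \<Longrightarrow> c \<le> cb \<Longrightarrow> derivable (- (c *\<^sub>R \<pi>b)) (c * of_int b0)"
      by blast
    show ?thesis
    proof (intro exI[of _ "real N * min ca cb"] conjI allI impI)
      show "real N * min ca cb > 0" using N(2) ca(1) cb(1) by simp
      fix c assume c: "0 < c" "c \<le> real N * min ca cb"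
      \<comment> \<open>Scaling by \<open>1 / N\<close> turns the coefficient of
        \<open>\<pi>\<close> back into \<open>c\<close>. The leftover \<open>\<sigma>\<close> terms
        only strengthen the bound from \<open>\<pi>a\<close> for
        \<open>\<sigma> \<bullet> x \<le> \<sigma>0\<close> and the bound from \<open>\<pi>b\<close>
        for \<open>\<sigma> \<bullet> x \<ge> \<sigma>0 + 1\<close>.\<close>
      define d where "d = c / real N"
      have "d \<le> min ca cb" using c(2) N(2) unfolding d_def by (metis mult.commute pos_divide_le_eq)
      then have d: "d > 0" "d \<le> ca" "d \<le> cb" using c(1) N(2) by (auto simp: d_def)
      have dN: "d * (real N * y) = c * y" for y using N(2) by (simp add: d_def)
      from ca(2)[OF d(1,2)] cb(2)[OF d(1,3)] \<sigma>
      show "derivable (- (c *\<^sub>R \<pi>)) (c * of_int \<pi>0)"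
      proof (rule derivable_split)
        fix x assume x: "\<sigma> \<bullet> x \<le> of_int \<sigma>0"
        have "real N * (\<pi> \<bullet> x - of_int \<pi>0) \<le> \<pi>a \<bullet> x - of_int a0" using a_eq[of x] x by linarith
        then have "d * (real N * (\<pi> \<bullet> x - of_int \<pi>0)) \<le> d * (\<pi>a \<bullet> x - of_int a0)"
          using d(1) by (intro mult_left_mono) auto
        then show "- (d *\<^sub>R \<pi>a) \<bullet> x + d * of_int a0 \<le> - (c *\<^sub>R \<pi>) \<bullet> x + c * of_int \<pi>0"
          unfolding dN by (simp add: algebra_simps)
      next
        fix x assume x: "\<sigma> \<bullet> x \<ge> of_int \<sigma>0 + 1"
        have "real N * (\<pi> \<bullet> x - of_int \<pi>0) \<le> \<pi>b \<bullet> x - of_int b0" using b_eq[of x] x by linarith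
        then have "d * (real N * (\<pi> \<bullet> x - of_int \<pi>0)) \<le> d * (\<pi>b \<bullet> x - of_int b0)"
          using d(1) by (intro mult_left_mono) auto
        then show "- (d *\<^sub>R \<pi>b) \<bullet> x + d * of_int b0 \<le> - (c *\<^sub>R \<pi>) \<bullet> x + c * of_int \<pi>0"
          unfolding dN by (simp add: algebra_simps)
      qed
    qed
  qed
  define F where "F = int_hull L \<inter> {x. \<pi> \<bullet> x = of_int \<pi>0}"
  have "int_hull L \<subseteq> {x. \<pi> \<bullet> x \<le> of_int \<pi>0}"
    unfolding int_hull_def using le by (intro hull_minimal convex_halfspace_le) auto
  then have F_face: "F face_of int_hull L"
    unfolding F_def by (intro face_of_Int_supporting_hyperplane_le) (auto simp: int_hull_def)
  have F_int: "F \<inter> {z. int_vec z} = S"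
    unfolding F_def S_def using int_hull_int_vec by auto
  show ?case
  proof (cases "\<exists>G. G facet_of L \<and> F \<subseteq> G")
    case True
    then show ?thesis using facet F_int by blast
  next
    case False
    then have "two_partitionable S"
      using two_hyp F_face F_int unfolding two_hyperplane_property_def by blast
    then consider a where "S \<subseteq> {a}" | S1 S2 \<sigma> and \<sigma>0 :: int where "S1 \<noteq> {}" "S2 \<noteq> {}" "S1 \<union> S2 = S" "int_vec \<sigma>"
        "S1 \<subseteq> {x. \<sigma> \<bullet> x = of_int \<sigma>0}" "S2 \<subseteq> {x. \<sigma> \<bullet> x = of_int \<sigma>0 + 1}"
      unfolding two_partitionable_def by (metis Un_commute)
    then show ?thesis
    proof cases
      case 1
      \<comment> \<open>A single integer point of the lattice-free \<open>L\<close> lies in some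
        facet, which returns to the facet case.\<close>
      obtain G where "G facet_of L" "z1 \<in> G" using int_vec_in_facet[OF z1(1,2)] .
      moreover have "S = {z1}" using 1 z1S by blast
      ultimately show ?thesis using facet by blast
    next
      case 2
      then show ?thesis by (rule split)
    qed
  qed
qed

text \<open>The functional \<open>\<pi> = 0\<close> exposes the whole integer hull and makes every
  bound zero. When \<open>L\<close> has no integer points, the zero bound is strict at all integer
  points and follows directly.\<close>

lemma derivable_zero:
  assumes "two_hyperplane_property L"
  shows "derivable 0 0"
proof (cases "L \<inter> {z. int_vec z} = {}")
  case True
  obtain \<eta>1 where \<eta>1: "\<eta>1 > 0"
    "\<And>a b p. norm a \<le> \<eta>1 \<Longrightarrow> \<bar>b\<bar> \<le> \<eta>1 \<Longrightarrow> p \<in> relaxation \<Longrightarrow> int_vec (fst p) \<Longrightarrow> fst p \<notin> L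
      \<Longrightarrow> slack p < a \<bullet> fst p + b"
    using slack_outside_less_small_affine by blast
  obtain \<eta>2 where \<eta>2: "\<eta>2 > 0"
    "\<And>a b. norm a \<le> \<eta>2 \<Longrightarrow> (\<And>p. p \<in> relaxation \<Longrightarrow> int_vec (fst p) \<Longrightarrow> slack p < a \<bullet> fst p + b)
      \<Longrightarrow> derivable a b"
    using derivable_strict_int by blast
  show ?thesis
  proof (rule \<eta>2(2))
    fix p assume "p \<in> relaxation" "int_vec (fst p)"
    moreover from this have "fst p \<notin> L" using True by blast
    ultimately show "slack p < 0 \<bullet> fst p + 0" using \<eta>1(1) by (intro \<eta>1(2)) auto
  qed (use \<eta>2(1) in simp)
next
  case False
  then obtain z1 where z1: "z1 \<in> L" "int_vec z1" by blast
  have "int_vec (0 :: real^'m)" by (simp add: int_vec_def)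
  then obtain c0 where "c0 > 0" "\<And>c. 0 < c \<Longrightarrow> c \<le> c0 \<Longrightarrow> derivable (- (c *\<^sub>R 0)) (c * of_int 0)"
    using derivable_exposed_face[OF assms, of 0 0 z1] z1 by auto
  then show ?thesis by force
qed

section \<open>Lifting points of \<open>L\<close>, and infinite rank\<close>

lemma slack_nonneg_lift:
  assumes corners: "rays_into_corners L f r" and "x \<in> L"
  obtains p where "p \<in> relaxation" "fst p = x" "slack p \<ge> 0"
proof -
  let ?A = "relaxation \<inter> {p. slack p \<ge> 0}"
  have "{p. slack p \<ge> 0} = {p. (0, gauge_vec) \<bullet> p \<le> 1}"
    by (auto simp: slack_def inner_prod_def)
  then have "convex ?A"
    using convex_relaxation by (auto intro!: convex_Int convex_halfspace_le)
  then have conv: "convex (fst ` ?A)"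
    by (intro convex_linear_image linear_fst)
  \<comment> \<open>This is where rays into the corners enter: a vertex is reached along a single
    ray with coefficient \<open>c\<close>, and \<open>gauge_le\<close> shows that this lift is not
    strictly inside the cut. Convexity extends the lifts to all of \<open>L\<close>.\<close>
  have "v \<in> fst ` ?A" if v: "v extreme_point_of L" for v
  proof -
    obtain j c where c: "c \<ge> 0" "v = f + c *\<^sub>R r j" "v \<in> frontier L"
      using corners v unfolding rays_into_corners_def ray_boundary_points_def by blast
    have "v \<noteq> f" using c(3) f_int by (auto simp: frontier_def)
    then have c0: "c > 0" using c by (cases "c = 0") auto
    have "v \<in> L" using v by (simp add: extreme_point_of_def)
    then have g: "gauge L f (r j) \<le> 1 / c" using gauge_le[OF c0] c(2) by blast
    let ?s = "axis j c :: real^'k"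
    have "(v, ?s) \<in> relaxation"
      using c(1,2) by (intro relaxationI) (auto simp: axis_def if_distrib[of "\<lambda>t. t *\<^sub>R _"] cong: if_cong)
    moreover have "gauge L f (r j) * c \<le> 1" using g c0 by (simp add: field_simps)
    then have "slack (v, ?s) \<ge> 0"
      by (simp add: slack_def inner_axis gauge_vec_def)
    ultimately show ?thesis by force
  qed
  then have "convex hull {v. v extreme_point_of L} \<subseteq> fst ` ?A"
    using conv by (intro hull_minimal) auto
  then have "x \<in> fst ` ?A"
    using Krein_Milman_Minkowski[OF compact_L convex_L] \<open>x \<in> L\<close> by blast
  then show thesis using that by auto
qed

text \<open>An interior point is a proper average of \<open>f\<close>, whose lift has violation 1,
  and a point of \<open>L\<close> slightly beyond it, whose lift has nonnegative violation.\<close>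

lemma slack_pos_lift:
  assumes corners: "rays_into_corners L f r" and "x \<in> interior L"
  obtains p where "p \<in> relaxation" "fst p = x" "slack p > 0"
proof -
  obtain e where e: "e > 0" "ball x e \<subseteq> L"
    using assms(2) by (auto simp: mem_interior)
  define d where "d = e / (norm (x - f) + 1)"
  have d: "d > 0" using e(1) by (simp add: d_def add_nonneg_pos)
  have "norm (d *\<^sub>R (x - f)) < e"
  proof -
    have "norm (d *\<^sub>R (x - f)) = d * norm (x - f)" using d by simp
    also have "\<dots> < d * (norm (x - f) + 1)" using d by simp
    also have "\<dots> = e" unfolding d_def by (simp add: add_nonneg_eq_0_iff)
    finally show ?thesis .
  qed
  then have "x + d *\<^sub>R (x - f) \<in> L"
    using e(2) by (auto simp: dist_norm)
  then obtain q where q: "q \<in> relaxation" "fst q = x + d *\<^sub>R (x - f)" "slack q \<ge> 0"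
    using slack_nonneg_lift[OF corners] by metis
  define u where "u = d / (1 + d)"
  define v where "v = 1 / (1 + d)"
  have uv: "u > 0" "v > 0" "u + v = 1"
    using d by (auto simp: u_def v_def simp flip: add_divide_distrib)
  have f0: "(f, 0) \<in> relaxation" "slack (f, 0) = 1"
    by (auto intro!: relaxationI simp: slack_def)
  show thesis
  proof (rule that)
    show "u *\<^sub>R (f, 0) + v *\<^sub>R q \<in> relaxation"
      using convexD[OF convex_relaxation f0(1) q(1)] uv by simp
    have v1: "v * (1 + d) = 1" and "u = v * d" using d by (auto simp: u_def v_def)
    have "fst (u *\<^sub>R (f, 0) + v *\<^sub>R q) = (v * (1 + d)) *\<^sub>R x"
      unfolding fst_add fst_scaleR fst_conv q(2) \<open>u = v * d\<close>
      by (simp add: algebra_simps)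
    then show "fst (u *\<^sub>R (f, 0) + v *\<^sub>R q) = x" unfolding v1 by simp
    have "slack (u *\<^sub>R (f, 0) + v *\<^sub>R q) = u + v * slack q"
      unfolding slack_affine[OF uv(3)] f0(2) by simp
    also have "\<dots> > 0" using uv q(3) by (simp add: add_pos_nonneg)
    finally show "slack (u *\<^sub>R (f, 0) + v *\<^sub>R q) > 0" .
  qed
qed

lemma violated_point_in_every_closure:
  assumes corners: "rays_into_corners L f r" and "\<not> two_hyperplane_property L"
  shows "\<exists>p \<in> (split_closure ^^ t) relaxation. slack p > 0"
proof -
  obtain F where F: "F face_of int_hull L" "\<not> (\<exists>G. G facet_of L \<and> F \<subseteq> G)"
    "\<not> two_partitionable (F \<inter> {z. int_vec z})"
    using assms(2) by (auto simp: two_hyperplane_property_def)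
  define S where "S = F \<inter> {z. int_vec z}"
  have SZ: "S \<subseteq> L \<inter> {z. int_vec z}"
    using face_of_imp_subset[OF F(1)] int_hull_int_vec by (auto simp: S_def)
  have finS: "finite S" using finite_subset[OF SZ finite_int_L] .
  have nS: "\<not> two_partitionable S" using F(3) by (simp add: S_def)
  then have "S \<noteq> {}" by (auto simp: two_partitionable_def)
  then have n: "real (card S) > 0" using finS by (simp add: card_gt_0_iff)
  define x where "x = (1 / card S) *\<^sub>R (\<Sum>z\<in>S. z)"
  have xL: "x \<in> L"
    unfolding x_def scaleR_sum_right using finS SZ n
    by (intro convex_sum[OF _ convex_L]) auto
  \<comment> \<open>A facet through the barycentre would contain all of \<open>S\<close>. As a face
    of a hull of finitely many integer points, \<open>F\<close> is the hull of its integer points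
    and would lie in that facet too.\<close>
  have "x \<in> interior L"
  proof (rule ccontr)
    assume "x \<notin> interior L"
    then obtain G where G: "G facet_of L" "x \<in> G" using frontier_in_facet[OF xL] by blast
    obtain a b where ab: "L \<subseteq> {x. a \<bullet> x \<le> b}" "G = L \<inter> {x. a \<bullet> x = b}"
      using facet_of_polyhedron[OF polyhedron_L G(1)] by blast
    have "(\<Sum>z\<in>S. a \<bullet> z) = card S * (a \<bullet> x)"
      using n by (simp add: x_def inner_sum_right)
    then have "(\<Sum>z\<in>S. b - a \<bullet> z) = 0"
      using G(2) ab(2) by (simp add: sum_subtractf)
    then have "\<forall>z\<in>S. b - a \<bullet> z = 0"
      using finS ab(1) SZ by (subst (asm) sum_nonneg_eq_0_iff) auto
    then have SG: "S \<subseteq> G" using ab(2) SZ by auto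
    obtain S' where S': "S' \<subseteq> L \<inter> {z. int_vec z}" "F = convex hull S'"
      using face_of_convex_hull_subset[OF finite_imp_compact[OF finite_int_L]] F(1)
      unfolding int_hull_def by metis
    have "S' \<subseteq> S" using S' hull_subset[of S' convex] by (auto simp: S_def)
    moreover have "convex G" using G(1) facet_of_imp_face_of face_of_imp_convex by blast
    ultimately have "F \<subseteq> G" unfolding S'(2) using SG by (intro hull_minimal) auto
    then show False using F(2) G(1) by blast
  qed
  then obtain p0 where p0: "p0 \<in> relaxation" "fst p0 = x" "slack p0 > 0"
    using slack_pos_lift[OF corners] by blast
  have "\<forall>z\<in>S. \<exists>p. p \<in> relaxation \<and> fst p = z \<and> slack p \<ge> 0"
    using slack_nonneg_lift[OF corners] SZ by (metis IntD1 subsetD)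
  then obtain T where T: "\<And>z. z \<in> S \<Longrightarrow> T z \<in> relaxation" "\<And>z. z \<in> S \<Longrightarrow> fst (T z) = z"
      "\<And>z. z \<in> S \<Longrightarrow> slack (T z) \<ge> 0"
    by metis
  define m where "m = (1 / card S) *\<^sub>R (\<Sum>z\<in>S. T z)"
  have fst_m: "fst m = x"
    using T(2) by (simp add: m_def x_def fst_sum)
  have "slack m = (1 / card S) * (\<Sum>z\<in>S. slack (T z))"
    using n by (simp add: m_def slack_def snd_sum inner_sum_right sum_subtractf right_diff_distrib)
  then have slack_m: "slack m \<ge> 0" using T(3) by (simp add: sum_nonneg)
  \<comment> \<open>The violated point is kept above the barycentre so that the averaging step can
    be repeated. The lifts \<open>T z\<close> lie above integer points and are therefore in every
    iterate.\<close>
  have "\<exists>p \<in> (split_closure ^^ t) relaxation. fst p = x \<and> slack p > 0"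
  proof (induction t)
    case 0
    then show ?case using p0 by auto
  next
    case (Suc t)
    then obtain p where p: "p \<in> (split_closure ^^ t) relaxation" "fst p = x" "slack p > 0" by blast
    define e where "e = 1 / (2 * real (card S))"
    have "(1 - e) *\<^sub>R m + e *\<^sub>R p \<in> split_closure ((split_closure ^^ t) relaxation)"
      unfolding e_def m_def
    proof (rule split_closure_average_step)
      show "convex ((split_closure ^^ t) relaxation)"
        by (rule convex_split_closure_power[OF convex_relaxation])
      show "T z \<in> (split_closure ^^ t) relaxation" if "z \<in> S" for z
        using int_vec_in_split_closure_power[OF T(1)[OF that]] T(2)[OF that] SZ that by auto
      show "fst p = (1 / card S) *\<^sub>R (\<Sum>z\<in>S. z)" using p(2) by (simp add: x_def)
    qed (use finS nS T(2) SZ p(1) in auto)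
    moreover have "fst ((1 - e) *\<^sub>R m + e *\<^sub>R p) = x"
      by (simp add: fst_m p(2) scaleR_left_diff_distrib)
    moreover have "slack ((1 - e) *\<^sub>R m + e *\<^sub>R p) > 0"
    proof -
      have "card S \<ge> 1" using n by simp
      then have e: "e > 0" "e \<le> 1" using n by (auto simp: e_def)
      have "slack ((1 - e) *\<^sub>R m + e *\<^sub>R p) = (1 - e) * slack m + e * slack p"
        by (rule slack_affine) simp
      also have "\<dots> > 0" using e slack_m p(3) by (simp add: add_nonneg_pos)
      finally show ?thesis .
    qed
    ultimately show ?case by (metis comp_apply funpow.simps(2))
  qed
  then show ?thesis by blast
qed

end

theorem theorem1:
  fixes f :: "real^'m" and r :: "'k::finite \<Rightarrow> real^'m" and L :: "(real^'m) set"
  assumes f_rat: "rat_vec f" and f_nonint: "\<not> int_vec f"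
    and r_rat: "\<And>j. rat_vec (r j)" and r_nz: "\<And>j. r j \<noteq> 0"
    and X_ne: "{(x, s). int_vec x \<and> (\<forall>j. s $ j \<ge> 0) \<and> x = f + (\<Sum>j\<in>UNIV. s $ j *\<^sub>R r j)} \<noteq> {}"
    and L_rat: "rational_polytope L" and L_lf: "lattice_free L"
    and f_int: "f \<in> interior L"
    and corners: "rays_into_corners L f r"
  shows "split_rank
           {(x, s). (\<forall>j. s $ j \<ge> 0) \<and> x = f + (\<Sum>j\<in>UNIV. s $ j *\<^sub>R r j)}
           {(x, s). (\<Sum>j\<in>UNIV. gauge L f (r j) * s $ j) \<ge> 1} < \<infinity>
         \<longleftrightarrow> two_hyperplane_property L"
proof -
  interpret lattice_free_cut f r L
    using r_nz L_rat L_lf f_int by unfold_locales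
  have cut: "{(x, s). (\<Sum>j\<in>UNIV. gauge L f (r j) * s $ j) \<ge> 1} = {p. slack p \<le> 0}"
    by (auto simp: slack_def gauge_vec_def inner_vec_def)
  have "(\<exists>t. (split_closure ^^ t) relaxation \<subseteq> {p. slack p \<le> 0}) \<longleftrightarrow> two_hyperplane_property L"
  proof
    assume "\<exists>t. (split_closure ^^ t) relaxation \<subseteq> {p. slack p \<le> 0}"
    then show "two_hyperplane_property L"
      using violated_point_in_every_closure[OF corners] by force
  next
    assume "two_hyperplane_property L"
    then show "\<exists>t. (split_closure ^^ t) relaxation \<subseteq> {p. slack p \<le> 0}"
      using derivable_zero by (auto simp: derivable_def)
  qed
  then show ?thesis
    unfolding relaxation_def[symmetric] cut by (auto simp: split_rank_def)
qed

end
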